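(* Let $\Gamma$ be a dense countable subgroup of $\mathbb{R}$ containing $1$. Then for every $k\ge 0$ there is an isomorphism $H_k(\mathcal{G}_\Gamma)\cong H_{k+1}(\Gamma)$ between the groupoid homology of $\mathcal{G}_\Gamma$ and the (shifted) group homology of $\Gamma$, both with coefficients in $\mathbb{Z}$.
   Context: Let $\mathbb{R}_\Gamma=(\mathbb{R}\setminus\Gamma)\sqcup\{a_+,a_-:a\in\Gamma\}$, with $q:\mathbb{R}_\Gamma\to\mathbb{R}$, $q(t)=t$, $q(a_\pm)=a$. Totally order $\mathbb{R}_\Gamma$ by $x<y$ if $q(x)<q(y)$, and $a_-<a_+$ for $a\in\Gamma$, and give it the order topology. $\Gamma$ acts on $\mathbb{R}_\Gamma$ by $\alpha_c(t)=t+c$ and $\alpha_c(a_\pm)=(a+c)_\pm$. Let $[0_+,1_-]=\{z\in\mathbb{R}_\Gamma:0_+\le z\le 1_-\}$, a clopen Cantor set. $\mathcal{G}_\Gamma=\Gamma\ltimes_\alpha[0_+,1_-]=\{(c,x): c\in\Gamma,\ x,\alpha_c(x)\in[0_+,1_-]\}$ is the restriction to $[0_+,1_-]$ of the transformation groupoid $\Gamma\ltimes\mathbb{R}_\Gamma$, with the subspace topology from $\Gamma\times\mathbb{R}_\Gamma$ ($\Gamma$ discrete). For an ample groupoid $\mathcal{G}$, the groupoid homology $H_*(\mathcal{G})$ (with coefficients in $\mathbb{Z}$) is the homology of the complex $\cdots\to C_c(\mathcal{G}^{(2)},\mathbb{Z})\to C_c(\mathcal{G}^{(1)},\mathbb{Z})\to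 C_c(\mathcal{G}^{(0)},\mathbb{Z})\to 0$, where $\mathcal{G}^{(n)}$ is the space of composable $n$-tuples and the differentials are the alternating sums of the push-forwards along the face maps of the nerve (in degree one, $s_*-r_*$). *)

theory Defs
  imports "HOL-Analysis.Analysis" "HOL-Algebra.Free_Abelian_Groups"
begin

section \<open>Homology of a chain complex\<close>

text \<open>A complex \<open>\<dots> \<rightarrow> C 1 \<rightarrow> C 0 \<rightarrow> 0\<close> with differentials \<open>d n\<close> from \<open>C n\<close> to \<open>C (n - 1)\<close>.
  Since every element of \<open>C 0\<close> is a cycle, \<open>d 0\<close> is irrelevant.\<close>

definition cycles :: "(nat \<Rightarrow> 'c monoid) \<Rightarrow> (nat \<Rightarrow> 'c \<Rightarrow> 'c) \<Rightarrow> nat \<Rightarrow> 'c set" where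
  "cycles C d n = (if n = 0 then carrier (C 0) else kernel (C n) (C (n - 1)) (d n))"

definition complex_homology ::
    "(nat \<Rightarrow> 'c monoid) \<Rightarrow> (nat \<Rightarrow> 'c \<Rightarrow> 'c) \<Rightarrow> nat \<Rightarrow> 'c set monoid" where
  "complex_homology C d n =
     (C n)\<lparr>carrier := cycles C d n\<rparr> Mod (d (Suc n) ` carrier (C (Suc n)))"


section \<open>Group homology with integer coefficients\<close>

text \<open>The inhomogeneous bar complex: degree \<open>n\<close> is free abelian on the \<open>n\<close>-tuples
  \<open>[g\<^sub>1|\<dots>|g\<^sub>n]\<close> of group elements.\<close>

definition bar_chains :: "('g, 'm) monoid_scheme \<Rightarrow> nat \<Rightarrow> ('g list \<Rightarrow>\<^sub>0 int) monoid" where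
  "bar_chains G n = free_Abelian_group {xs. length xs = n \<and> set xs \<subseteq> carrier G}"

definition bar_face :: "('g, 'm) monoid_scheme \<Rightarrow> nat \<Rightarrow> 'g list \<Rightarrow> 'g list" where
  "bar_face G i xs =
     (if i = 0 then tl xs
      else if i = length xs then butlast xs
      else take (i - 1) xs @ (xs ! (i - 1) \<otimes>\<^bsub>G\<^esub> xs ! i) # drop (i + 1) xs)"

definition bar_boundary ::
    "('g, 'm) monoid_scheme \<Rightarrow> ('g list \<Rightarrow>\<^sub>0 int) \<Rightarrow> ('g list \<Rightarrow>\<^sub>0 int)" where
  "bar_boundary G =
     frag_extend (\<lambda>xs. \<Sum>i\<le>length xs. frag_cmul ((-1) ^ i) (frag_of (bar_face G i xs)))"

definition group_homology ::
    "('g, 'm) monoid_scheme \<Rightarrow> nat \<Rightarrow> ('g list \<Rightarrow>\<^sub>0 int) set monoid" where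
  "group_homology G = complex_homology (bar_chains G) (\<lambda>_. bar_boundary G)"


section \<open>Topological groupoids and their homology\<close>

text \<open>The unit space is regarded as a subset of the space of arrows. The product
  \<open>gmult G g h\<close> is meaningful when \<open>src G g = rng G h\<close>.\<close>

record 'a top_groupoid =
  arrows :: "'a topology"
  src :: "'a \<Rightarrow> 'a"
  rng :: "'a \<Rightarrow> 'a"
  gmult :: "'a \<Rightarrow> 'a \<Rightarrow> 'a"
  ginv :: "'a \<Rightarrow> 'a"

definition gunits :: "'a top_groupoid \<Rightarrow> 'a set" where
  "gunits G = src G ` topspace (arrows G)"

text \<open>A composable \<open>n\<close>-tuple \<open>(g\<^sub>1, \<dots>, g\<^sub>n)\<close> is the extensional function on \<open>{..<n}\<close> with
  \<open>g i = g\<^sub>i\<^sub>+\<^sub>1\<close>. In degree zero, a unit \<open>u\<close> is the function on \<open>{..<1}\<close> with value \<open>u\<close>,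
  so that all degrees share one type.\<close>

definition nerve :: "'a top_groupoid \<Rightarrow> nat \<Rightarrow> (nat \<Rightarrow> 'a) topology" where
  "nerve G n =
     (if n = 0
      then subtopology (product_topology (\<lambda>_. arrows G) {..<1}) {g. g 0 \<in> gunits G}
      else subtopology (product_topology (\<lambda>_. arrows G) {..<n})
             {g. \<forall>i. Suc i < n \<longrightarrow> src G (g i) = rng G (g (Suc i))})"

definition nerve_face ::
    "'a top_groupoid \<Rightarrow> nat \<Rightarrow> nat \<Rightarrow> (nat \<Rightarrow> 'a) \<Rightarrow> (nat \<Rightarrow> 'a)" where
  "nerve_face G n i g =
     (if n = 1 then (\<lambda>j\<in>{..<1}. if i = 0 then src G (g 0) else rng G (g 0))
      else (\<lambda>j\<in>{..<n - 1}.
        if i = 0 then g (Suc j)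
        else if i = n then g j
        else if Suc j < i then g j
        else if Suc j = i then gmult G (g j) (g (Suc j))
        else g (Suc j)))"

text \<open>The group \<open>C\<^sub>c(X, \<int>)\<close>; functions on \<open>X\<close> are extended by zero to the whole type.\<close>

definition Cc :: "'x topology \<Rightarrow> ('x \<Rightarrow> int) monoid" where
  "Cc X = \<lparr>carrier = {f. continuous_map X (discrete_topology UNIV) f
                       \<and> compactin X (Abstract_Topology.closure_of X {x \<in> topspace X. f x \<noteq> 0})
                       \<and> (\<forall>x. x \<notin> topspace X \<longrightarrow> f x = 0)},
           mult = (\<lambda>f g x. f x + g x), one = (\<lambda>_. 0)\<rparr>"

text \<open>Only the points of the fibre where \<open>f\<close> is nonzero are summed over: a fibre of a local
  homeomorphism may be infinite, but meets the support of \<open>f\<close> in a finite set.\<close>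

definition push_forward ::
    "'x topology \<Rightarrow> ('x \<Rightarrow> 'y) \<Rightarrow> ('x \<Rightarrow> int) \<Rightarrow> ('y \<Rightarrow> int)" where
  "push_forward X \<phi> f = (\<lambda>y. \<Sum>x | x \<in> topspace X \<and> \<phi> x = y \<and> f x \<noteq> 0. f x)"

definition nerve_boundary ::
    "'a top_groupoid \<Rightarrow> nat \<Rightarrow> ((nat \<Rightarrow> 'a) \<Rightarrow> int) \<Rightarrow> ((nat \<Rightarrow> 'a) \<Rightarrow> int)" where
  "nerve_boundary G n f =
     (\<lambda>y. \<Sum>i\<le>n. (-1) ^ i * push_forward (nerve G n) (nerve_face G n i) f y)"

definition groupoid_homology ::
    "'a top_groupoid \<Rightarrow> nat \<Rightarrow> ((nat \<Rightarrow> 'a) \<Rightarrow> int) set monoid" where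
  "groupoid_homology G = complex_homology (\<lambda>n. Cc (nerve G n)) (nerve_boundary G)"


section \<open>Transformation groupoids and restrictions\<close>

text \<open>The arrow \<open>(c, x)\<close> goes from \<open>x\<close> to \<open>\<alpha> c x\<close>; the point \<open>x\<close> is identified with the
  unit \<open>(\<one>, x)\<close>. The acting group is discrete.\<close>

definition transformation_groupoid ::
    "('g, 'm) monoid_scheme \<Rightarrow> 'x topology \<Rightarrow> ('g \<Rightarrow> 'x \<Rightarrow> 'x) \<Rightarrow> ('g \<times> 'x) top_groupoid" where
  "transformation_groupoid G X \<alpha> =
     \<lparr>arrows = prod_topology (discrete_topology (carrier G)) X,
      src = (\<lambda>(c, x). (\<one>\<^bsub>G\<^esub>, x)),
      rng = (\<lambda>(c, x). (\<one>\<^bsub>G\<^esub>, \<alpha> c x)),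
      gmult = (\<lambda>(d, y) (c, x). (d \<otimes>\<^bsub>G\<^esub> c, x)),
      ginv = (\<lambda>(c, x). (inv\<^bsub>G\<^esub> c, \<alpha> c x))\<rparr>"

definition restrict_groupoid :: "'a top_groupoid \<Rightarrow> 'a set \<Rightarrow> 'a top_groupoid" where
  "restrict_groupoid G U =
     G\<lparr>arrows := subtopology (arrows G) {g. src G g \<in> U \<and> rng G g \<in> U}\<rparr>"


section \<open>The line with the points of \<open>\<Gamma>\<close> doubled\<close>

text \<open>\<open>Below a\<close> and \<open>Above a\<close> are the points \<open>a\<^sub>-\<close> and \<open>a\<^sub>+\<close>.\<close>

datatype cut_point = Ordinary real | Below real | Above real

fun cut_proj :: "cut_point \<Rightarrow> real" where
  "cut_proj (Ordinary t) = t"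
| "cut_proj (Below a) = a"
| "cut_proj (Above a) = a"

definition cut_line :: "real set \<Rightarrow> cut_point set" where
  "cut_line \<Gamma> = Ordinary ` (- \<Gamma>) \<union> Below ` \<Gamma> \<union> Above ` \<Gamma>"

definition cut_less :: "cut_point \<Rightarrow> cut_point \<Rightarrow> bool" where
  "cut_less x y \<longleftrightarrow> cut_proj x < cut_proj y \<or> (\<exists>a. x = Below a \<and> y = Above a)"

definition cut_le :: "cut_point \<Rightarrow> cut_point \<Rightarrow> bool" where
  "cut_le x y \<longleftrightarrow> cut_less x y \<or> x = y"

definition order_topology_on :: "'x set \<Rightarrow> ('x \<Rightarrow> 'x \<Rightarrow> bool) \<Rightarrow> 'x topology" where
  "order_topology_on A lt =
     topology_generated_by
       (insert A ((\<lambda>x. {z \<in> A. lt z x}) ` A \<union> (\<lambda>x. {z \<in> A. lt x z}) ` A))"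

definition cut_topology :: "real set \<Rightarrow> cut_point topology" where
  "cut_topology \<Gamma> = order_topology_on (cut_line \<Gamma>) cut_less"

fun cut_shift :: "real \<Rightarrow> cut_point \<Rightarrow> cut_point" where
  "cut_shift c (Ordinary t) = Ordinary (t + c)"
| "cut_shift c (Below a) = Below (a + c)"
| "cut_shift c (Above a) = Above (a + c)"

definition cut_interval :: "real set \<Rightarrow> cut_point set" where
  "cut_interval \<Gamma> = {z \<in> cut_line \<Gamma>. cut_le (Above 0) z \<and> cut_le z (Below 1)}"

definition real_add :: "real monoid" where
  "real_add = \<lparr>carrier = UNIV, mult = (+), one = 0\<rparr>"

definition cut_groupoid :: "real set \<Rightarrow> (real \<times> cut_point) top_groupoid" where
  "cut_groupoid \<Gamma> =
     restrict_groupoid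
       (transformation_groupoid (real_add\<lparr>carrier := \<Gamma>\<rparr>) (cut_topology \<Gamma>) cut_shift)
       ({0} \<times> cut_interval \<Gamma>)"

end

theory Submission imports Defs begin

text \<open>A locally constant function of compact support on the cut line is determined by its finitely many
  jumps, which are points of \<open>\<Gamma>\<close> and add up to zero. Recording jumps identifies the chains of degree
  \<open>n\<close> of the groupoid with those combinations \<open>y\<close> of bar tuples \<open>[- v|c\<^sub>1|\<dots>|c\<^sub>n]\<close> of degree
  \<open>n + 1\<close> for which all vertices \<open>v, v - c\<^sub>1, v - c\<^sub>1 - c\<^sub>2, \<dots>\<close> lie in \<open>[0, 1]\<close> and the \<open>0\<close>-th face of
  \<open>y\<close> vanishes. Up to sign the nerve boundary becomes the bar boundary, so it remains to see that the
  inclusion of these chains into the bar complex, with a shift of degree by one, induces isomorphisms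
  in homology.

  Every bar cycle is homologous to one supported on tuples of diameter at most \<open>1\<close>, because \<open>1 \<in> \<Gamma>\<close>
  allows one to insert the vertex \<open>min + 1\<close> in longer tuples. If \<open>y\<close> is such a cycle, and \<open>s y\<close>
  arises by putting the minimal vertex in front of every tuple, then \<open>y - \<partial> (s y)\<close> is a combination
  of the required kind. The same construction, corrected by the cone \<open>0 # y\<close>, shows that such
  combinations which bound in the bar complex bound among themselves.\<close>

section \<open>Combinations of generators\<close>

text \<open>Over the whole cut line, jumps identify the compactly supported locally constant
  functions with the kernel of the augmentation \<int>[\<Gamma>] \<rightarrow> \<int>. The free
  module \<int>[\<Gamma>] has no homology in positive degrees, and this is the origin of the shift
  by one. The argument realises it on chains and directly over the interval.

  The obstacle is that the groupoid chains are not spanned by a set of tuples: the vanishing of the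
  \<open>0\<close>-th face is a linear condition, and a homotopy defined tuple by tuple does not
  respect it. Tuples of diameter at most \<open>1\<close>, in contrast, form a Vietoris-Rips
  complex, which is closed under faces, so the homotopy acts there and cones repair the
  \<open>0\<close>-th face afterwards. The scale is \<open>1\<close> because the interval has length
  \<open>1\<close>: vertices fit into a translate of \<open>[0, 1]\<close> exactly if their diameter
  is at most \<open>1\<close>, and their minimum can serve as its left end.\<close>

abbreviation frag_map :: "('a \<Rightarrow> 'b) \<Rightarrow> ('a \<Rightarrow>\<^sub>0 int) \<Rightarrow> ('b \<Rightarrow>\<^sub>0 int)" where
  "frag_map f \<equiv> frag_extend (\<lambda>x. frag_of (f x))"

lemma frag_extend_extend:
  "frag_extend f (frag_extend g c) = frag_extend (\<lambda>x. frag_extend f (g x)) c"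
  by (induction c rule: frag_induction[OF subset_UNIV]) (auto simp: frag_extend_diff)

lemma frag_extend_fun_diff:
  "frag_extend (\<lambda>x. f x - g x) c = frag_extend f c - frag_extend g c"
  by (induction c rule: frag_induction[OF subset_UNIV]) (auto simp: frag_extend_diff)

lemma keys_frag_map: "Poly_Mapping.keys (frag_map f c) \<subseteq> f ` Poly_Mapping.keys c"
  using keys_frag_extend[of "\<lambda>x. frag_of (f x)" c] by (auto simp: keys_frag_of)

section \<open>Tuples and the bar complex\<close>

text \<open>The alternating sum of vertex deletions in the augmented complex, written as the
  boundary formula of a cone. A single vertex has the empty tuple as boundary, so the recursion has
  no exception; the price is that the empty tuple must be kept away from bar tuples, as
  \<open>gaps []\<close> and \<open>gaps [a]\<close> coincide.\<close>

primrec tuple_boundary :: "'a list \<Rightarrow> ('a list \<Rightarrow>\<^sub>0 int)" where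
  "tuple_boundary [] = 0"
| "tuple_boundary (a # v) = frag_of v - frag_map (Cons a) (tuple_boundary v)"

lemma tuple_boundary_cone:
  "frag_extend tuple_boundary (frag_map (Cons a) z) = z - frag_map (Cons a) (frag_extend tuple_boundary z)"
  by (induction z rule: frag_induction[OF subset_UNIV]) (auto simp: frag_extend_diff)

lemma tuple_boundary_boundary: "frag_extend tuple_boundary (tuple_boundary v) = 0"
  by (induction v) (auto simp: frag_extend_diff tuple_boundary_cone)

lemma keys_tuple_boundary:
  "x \<in> Poly_Mapping.keys (tuple_boundary v) \<Longrightarrow> \<exists>xs c ys. v = xs @ c # ys \<and> x = xs @ ys"
proof (induction v arbitrary: x)
  case (Cons a v)
  from Cons.prems have "x = v \<or> x \<in> Cons a ` Poly_Mapping.keys (tuple_boundary v)"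
    using keys_diff[of "frag_of v" "frag_map (Cons a) (tuple_boundary v)"]
      keys_frag_map[of "Cons a" "tuple_boundary v"] by (auto simp: keys_frag_of)
  then show ?case
  proof
    assume "x = v"
    then show ?thesis by (intro exI[of _ "[]"]) auto
  next
    assume "x \<in> Cons a ` Poly_Mapping.keys (tuple_boundary v)"
    then obtain x' where "x = a # x'" "x' \<in> Poly_Mapping.keys (tuple_boundary v)" by auto
    with Cons.IH obtain xs c ys where "v = xs @ c # ys" "x' = xs @ ys" by blast
    with \<open>x = a # x'\<close> show ?thesis by (intro exI[of _ "a # xs"]) auto
  qed
qed auto

text \<open>A bar tuple \<open>[g\<^sub>1|\<dots>|g\<^sub>n]\<close> is a tuple of vertices \<open>(v\<^sub>0, \<dots>, v\<^sub>n)\<close> up to translation,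
  with \<open>g\<^sub>i = v\<^sub>i\<^sub>-\<^sub>1 - v\<^sub>i\<close>; then the bar faces delete vertices.\<close>

fun gaps :: "real list \<Rightarrow> real list" where
  "gaps (a # b # v) = (a - b) # gaps (b # v)"
| "gaps _ = []"

primrec verts :: "real \<Rightarrow> real list \<Rightarrow> real list" where
  "verts b [] = [b]"
| "verts b (t # u) = b # verts (b - t) u"

lemma verts_nonempty [simp]: "verts b u \<noteq> []"
  by (cases u) auto

lemma hd_verts [simp]: "hd (verts b u) = b"
  by (cases u) auto

lemma length_verts [simp]: "length (verts b u) = Suc (length u)"
  by (induction u arbitrary: b) auto

lemma gaps_Cons: "v \<noteq> [] \<Longrightarrow> gaps (a # v) = (a - hd v) # gaps v"
  by (cases v) auto

lemma gaps_verts [simp]: "gaps (verts b u) = u"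
  by (induction u arbitrary: b) (auto simp: gaps_Cons)

lemma length_gaps [simp]: "length (gaps v) = length v - 1"
  by (induction v rule: gaps.induct) auto

lemma verts_gaps: "v \<noteq> [] \<Longrightarrow> verts b (gaps v) = map (\<lambda>x. x - hd v + b) v"
proof (induction v arbitrary: b rule: gaps.induct)
  case (1 a c v)
  then show ?case by (auto simp: algebra_simps)
qed auto

lemma exists_gaps: obtains v where "gaps v = u" "length v = Suc (length u)"
  using that[of "verts 0 u"] by simp

definition real_subgroup :: "real set \<Rightarrow> real monoid" where
  "real_subgroup \<Gamma> = real_add\<lparr>carrier := \<Gamma>\<rparr>"

text \<open>Faces of index at least two keep the first entry \<open>t\<close> and come from the
  faces of \<open>s # u\<close> of positive index. The term \<open>frag_of u\<close> takes away the
  face of index zero, which has no such extension.\<close>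

lemma bar_boundary_Cons2:
  "bar_boundary (real_subgroup \<Gamma>) (frag_of (t # s # u)) =
     frag_of (s # u) - frag_of ((t + s) # u)
     - frag_map (Cons t) (bar_boundary (real_subgroup \<Gamma>) (frag_of (s # u)) - frag_of u)"
proof -
  let ?G = "real_subgroup \<Gamma>"
  have 1: "bar_boundary ?G (frag_of (s # u)) - frag_of u =
     (\<Sum>i\<le>length u. frag_cmul ((-1) ^ Suc i) (frag_of (bar_face ?G (Suc i) (s # u))))"
    unfolding bar_boundary_def by (simp add: sum.atMost_Suc_shift bar_face_def del: sum.atMost_Suc)
  have 2: "bar_face ?G (Suc (Suc i)) (t # s # u) = t # bar_face ?G (Suc i) (s # u)" if "i \<le> length u" for i
    using that by (auto simp: bar_face_def)
  have 3: "bar_face ?G (Suc 0) (t # s # u) = (t + s) # u"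
    by (auto simp: bar_face_def real_subgroup_def real_add_def)
  have "bar_boundary ?G (frag_of (t # s # u)) = frag_of (s # u) - frag_of ((t + s) # u)
     + (\<Sum>i\<le>length u. frag_cmul ((-1) ^ i) (frag_of (t # bar_face ?G (Suc i) (s # u))))"
    unfolding bar_boundary_def using 2 3
    by (simp add: sum.atMost_Suc_shift del: sum.atMost_Suc) (simp add: bar_face_def)
  also have "(\<Sum>i\<le>length u. frag_cmul ((-1) ^ i) (frag_of (t # bar_face ?G (Suc i) (s # u))))
     = - frag_map (Cons t) (bar_boundary ?G (frag_of (s # u)) - frag_of u)"
    unfolding 1 by (simp add: frag_extend_sum frag_extend_cmul o_def flip: sum_negf)
  finally show ?thesis by simp
qed

text \<open>Deleting an inner vertex adds the two neighbouring differences, and deleting an end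
  vertex drops one. All later computations in the bar complex thereby reduce to the cone recursion
  of \<open>tuple_boundary\<close>.\<close>

lemma bar_boundary_gaps:
  "v \<noteq> [] \<Longrightarrow> bar_boundary (real_subgroup \<Gamma>) (frag_of (gaps v)) = frag_map gaps (tuple_boundary v)"
proof (induction v rule: gaps.induct)
  case (1 a b v)
  show ?case
  proof (cases v)
    case Nil
    then show ?thesis by (simp add: bar_boundary_def bar_face_def frag_extend_diff)
  next
    case (Cons c r)
    \<comment> \<open>The faces of \<open>b # c # r\<close> that keep \<open>b\<close> are the ones
      in front of which the vertex \<open>a\<close> contributes the entry
      \<open>a - b\<close>.\<close>
    have "frag_map (Cons (a - b)) (frag_map gaps (frag_map (Cons b) z)) =
          frag_map gaps (frag_map (Cons a) (frag_map (Cons b) z))" for z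
      by (induction z rule: frag_induction[OF subset_UNIV]) (auto simp: frag_extend_diff)
    then show ?thesis using 1 Cons
      by (simp add: bar_boundary_Cons2 frag_extend_diff)
  qed
qed (auto simp: bar_boundary_def bar_face_def)

lemma bar_boundary_extend:
  "bar_boundary G z = frag_extend (\<lambda>u. bar_boundary G (frag_of u)) z"
  by (simp add: bar_boundary_def)

lemma bar_boundary_diff: "bar_boundary G (y - z) = bar_boundary G y - bar_boundary G z"
  by (simp add: bar_boundary_def frag_extend_diff)

lemma bar_boundary_add: "bar_boundary G (y + z) = bar_boundary G y + bar_boundary G z"
  by (simp add: bar_boundary_def frag_extend_add)

lemma bar_boundary_uminus: "bar_boundary G (- z) = - bar_boundary G z"
  by (simp add: bar_boundary_def frag_extend_minus)

lemma bar_boundary_0 [simp]: "bar_boundary G 0 = 0"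
  by (simp add: bar_boundary_def)

lemma bar_boundary_frag_map_gaps:
  assumes "[] \<notin> Poly_Mapping.keys z"
  shows "bar_boundary (real_subgroup \<Gamma>) (frag_map gaps z) = frag_map gaps (frag_extend tuple_boundary z)"
proof -
  have "bar_boundary (real_subgroup \<Gamma>) (frag_map gaps z)
      = frag_extend (\<lambda>v. bar_boundary (real_subgroup \<Gamma>) (frag_of (gaps v))) z"
    by (subst bar_boundary_extend) (simp add: frag_extend_extend)
  also have "\<dots> = frag_extend (\<lambda>v. frag_map gaps (tuple_boundary v)) z"
    using assms by (intro frag_extend_eq bar_boundary_gaps) auto
  finally show ?thesis by (simp add: frag_extend_extend)
qed

lemma nonempty_keys_tuple_boundary:
  "2 \<le> length v \<Longrightarrow> [] \<notin> Poly_Mapping.keys (tuple_boundary v)"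
  using keys_tuple_boundary[of "[]" v] by fastforce

text \<open>Lifting to vertices reduces this to \<open>tuple_boundary_boundary\<close>. The empty
  bar tuple is an exception, since the boundary formula sends it to itself.\<close>

lemma bar_boundary_boundary:
  assumes "[] \<notin> Poly_Mapping.keys z"
  shows "bar_boundary (real_subgroup \<Gamma>) (bar_boundary (real_subgroup \<Gamma>) z) = 0"
proof -
  have "bar_boundary (real_subgroup \<Gamma>) (bar_boundary (real_subgroup \<Gamma>) (frag_of u)) = 0"
    if "u \<noteq> []" for u
  proof -
    obtain v where v: "gaps v = u" "length v = Suc (length u)" by (rule exists_gaps)
    then have "2 \<le> length v" using that by (cases u) auto
    then have "bar_boundary (real_subgroup \<Gamma>) (bar_boundary (real_subgroup \<Gamma>) (frag_of (gaps v))) = 0"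
      using nonempty_keys_tuple_boundary[of v]
      by (subst bar_boundary_gaps) (auto simp: bar_boundary_frag_map_gaps tuple_boundary_boundary)
    then show ?thesis using v(1) by simp
  qed
  with assms have "frag_extend (\<lambda>u. bar_boundary (real_subgroup \<Gamma>)
      (bar_boundary (real_subgroup \<Gamma>) (frag_of u))) z = 0"
    by (intro frag_extend_eq_0) metis
  then show ?thesis
    unfolding bar_boundary_def frag_extend_extend by simp
qed

section \<open>Tuples of diameter at most one\<close>

text \<open>The position of the minimal vertex relative to the first one, so that
  \<open>(low u + t) # u\<close> puts the vertex \<open>min + t\<close> in front of the
  tuple.\<close>

definition low :: "real list \<Rightarrow> real" where
  "low u = Min (set (verts 0 u))"

definition spread :: "real list \<Rightarrow> real" where
  "spread u = Max (set (verts 0 u)) - Min (set (verts 0 u))"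

text \<open>The termination measure for shortening tuples: whole units by which the vertices lie
  below the maximum. Integer parts make it a natural number although the vertices are real.\<close>

definition weight :: "real list \<Rightarrow> nat" where
  "weight u = (\<Sum>x\<leftarrow>verts 0 u. nat \<lfloor>Max (set (verts 0 u)) - x\<rfloor>)"

lemma verts_0_gaps: "v \<noteq> [] \<Longrightarrow> verts 0 (gaps v) = map (\<lambda>x. x - hd v) v"
  by (simp add: verts_gaps)

lemma Min_set_shift: "v \<noteq> [] \<Longrightarrow> Min (set (map (\<lambda>x. x - c) v)) = Min (set v) - (c::real)"
  using Min_add_commute[of "set v" "\<lambda>x. x" "- c"] by simp

lemma Max_set_shift: "v \<noteq> [] \<Longrightarrow> Max (set (map (\<lambda>x. x - c) v)) = Max (set v) - (c::real)"
  using Max_add_commute[of "set v" "\<lambda>x. x" "- c"] by simp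

lemma low_gaps: "v \<noteq> [] \<Longrightarrow> low (gaps v) = Min (set v) - hd v"
  by (simp add: low_def verts_0_gaps Min_set_shift del: set_map)

lemma spread_gaps: "v \<noteq> [] \<Longrightarrow> spread (gaps v) = Max (set v) - Min (set v)"
  by (simp add: spread_def verts_0_gaps Min_set_shift Max_set_shift del: set_map)

lemma weight_gaps: "v \<noteq> [] \<Longrightarrow> weight (gaps v) = (\<Sum>x\<leftarrow>v. nat \<lfloor>Max (set v) - x\<rfloor>)"
  by (simp add: weight_def verts_0_gaps Max_set_shift o_def del: set_map)

lemma low_Cons_gaps: "v \<noteq> [] \<Longrightarrow> (low (gaps v) + t) # gaps v = gaps ((Min (set v) + t) # v)"
  by (simp add: low_gaps gaps_Cons)

definition short :: "real list set" where
  "short = {u. spread u \<le> 1}"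

lemma short_gapsI:
  assumes "v \<noteq> []" "\<And>x. x \<in> set v \<Longrightarrow> b \<le> x \<and> x \<le> b + 1"
  shows "gaps v \<in> short"
proof -
  have "Max (set v) \<in> set v" "Min (set v) \<in> set v" using assms(1) by auto
  with assms(2) have "Max (set v) \<le> b + 1" "b \<le> Min (set v)" by blast+
  then have "spread (gaps v) \<le> 1" unfolding spread_gaps[OF assms(1)] by linarith
  then show ?thesis by (simp add: short_def)
qed

lemma short_gapsD:
  assumes "gaps v \<in> short" "x \<in> set v"
  shows "Min (set v) \<le> x \<and> x \<le> Min (set v) + 1"
proof -
  have "x \<le> Max (set v)" "Min (set v) \<le> x" using assms by auto
  moreover have "v \<noteq> []" using assms by auto
  then have "Max (set v) - Min (set v) \<le> 1" using assms(1) by (simp add: short_def spread_gaps)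
  ultimately show ?thesis by simp
qed

lemma short_gaps_subset:
  assumes "gaps v \<in> short" "set x \<subseteq> set v"
  shows "gaps x \<in> short"
proof (cases "x = []")
  case True
  then show ?thesis using short_gapsI[of "[0]" 0] by simp
next
  case False
  then show ?thesis
    using short_gapsD[OF assms(1)] assms(2) by (intro short_gapsI[of x "Min (set v)"]) blast+
qed

text \<open>The homotopy that makes the tuples of diameter at most \<open>1\<close> carry the homology of the bar
  complex: it inserts the vertex \<open>min + 1\<close>. On a longer tuple this changes neither end, so every face
  that keeps the minimum cancels, and the others trade the minimum for a vertex that is larger by at
  least \<open>1\<close>, which lowers \<open>weight\<close>.\<close>

definition stretch :: "real list \<Rightarrow> (real list \<Rightarrow>\<^sub>0 int)" where
  "stretch u = (if u \<in> short then 0 else frag_of ((low u + 1) # u))"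

text \<open>Since \<open>c + 1 \<le> a \<le> Max (set v)\<close>, the deleted minimum
  \<open>c\<close> is not the maximum, so all summands are still measured from the same point.
  Trading \<open>c\<close> for \<open>a\<close> lowers one integer part by at least one, and
  \<open>a\<close> below the maximum keeps the truncation by \<open>nat\<close> harmless.\<close>

lemma weight_cone_less:
  assumes v: "v = xs @ c # ys" and c: "c < Min (set (xs @ ys))" and x: "xs @ ys \<noteq> []"
    and a: "c + 1 \<le> a" "a \<le> Max (set v)"
  shows "weight (gaps (a # xs @ ys)) < weight (gaps v)"
proof -
  define M where "M = Max (set v)"
  have M: "Max (set (xs @ ys)) = M"
  proof (rule Max_eqI)
    have "M \<in> set v" using v by (simp add: M_def del: set_append)
    moreover have "M \<noteq> c" using a by (simp add: M_def)
    ultimately show "M \<in> set (xs @ ys)" using v by auto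
  qed (auto simp: M_def v)
  then have M': "Max (set (a # xs @ ys)) = M"
    using a x by (auto simp: M_def simp del: set_append)
  have "nat \<lfloor>M - a\<rfloor> < nat \<lfloor>M - c\<rfloor>"
    using a unfolding M_def by linarith
  then show ?thesis
    using x v by (simp add: weight_gaps M' del: set_append list.set) (simp add: M_def)
qed

lemma stretch_homotopy:
  assumes u: "u \<notin> short"
    and k: "k \<in> Poly_Mapping.keys (frag_of u - bar_boundary (real_subgroup \<Gamma>) (stretch u)
       - frag_extend stretch (bar_boundary (real_subgroup \<Gamma>) (frag_of u)))"
  shows "k \<in> short \<or> weight k < weight u"
proof -
  obtain v where v: "gaps v = u" "length v = Suc (length u)" by (rule exists_gaps)
  then have v0: "v \<noteq> []" by auto
  have "length v \<noteq> Suc 0"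
  proof
    assume "length v = Suc 0"
    then obtain b where "v = [b]" by (auto simp: length_Suc_conv)
    then show False using u v(1) short_gapsI[of "[0]" 0] by auto
  qed
  moreover have "length v \<noteq> 0" using v0 by simp
  ultimately have len: "2 \<le> length v" by linarith
  define m M where "m = Min (set v)" and "M = Max (set v)"
  have diam: "m + 1 < M" using u v v0 by (auto simp: short_def spread_gaps m_def M_def)
  have st: "stretch u = frag_of (gaps ((m + 1) # v))"
    using u v low_Cons_gaps[OF v0, of 1] by (simp add: stretch_def m_def)
  \<comment> \<open>The cone formula cancels \<open>frag_of u\<close> against the face opposite to
    the inserted vertex. What remains compares, over every face \<open>x\<close>, the cone with tip
    \<open>m + 1\<close> and the value of \<open>stretch\<close>.\<close>
  have "frag_of u - bar_boundary (real_subgroup \<Gamma>) (stretch u)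
       - frag_extend stretch (bar_boundary (real_subgroup \<Gamma>) (frag_of u))
     = frag_extend (\<lambda>x. frag_of (gaps ((m + 1) # x)) - stretch (gaps x)) (tuple_boundary v)"
    unfolding st using v(1) v0 bar_boundary_gaps[of "(m + 1) # v" \<Gamma>] bar_boundary_gaps[of v \<Gamma>]
    by (simp add: frag_extend_diff frag_extend_fun_diff frag_extend_extend)
  with k obtain x where x: "x \<in> Poly_Mapping.keys (tuple_boundary v)"
    and k: "k \<in> Poly_Mapping.keys (frag_of (gaps ((m + 1) # x)) - stretch (gaps x))"
    using keys_frag_extend by (metis (no_types, lifting) UN_E subsetD)
  obtain xs c ys where c: "v = xs @ c # ys" "x = xs @ ys" using keys_tuple_boundary[OF x] by blast
  have x0: "x \<noteq> []" using nonempty_keys_tuple_boundary[OF len] x by auto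
  define m' where "m' = Min (set x)"
  have m': "m' \<in> set x" using x0 by (simp add: m'_def)
  have sub: "set x \<subseteq> set v" using c by auto
  have bounds: "m \<le> y \<and> y \<le> M" if "y \<in> set v" for y using that by (simp add: m_def M_def)
  have "m \<in> set v" using v0 by (simp add: m_def)
  have stx: "stretch (gaps x) = (if gaps x \<in> short then 0 else frag_of (gaps ((m' + 1) # x)))"
    using low_Cons_gaps[OF x0, of 1] by (simp add: stretch_def m'_def)
  show ?thesis
  \<comment> \<open>A face that keeps the minimum is either long, and \<open>stretch\<close> uses
    the same tip, so that the terms cancel; or it lies in \<open>[m, m + 1]\<close>, and so does its
    cone.\<close>
  proof (cases "m' = m")
    case True
    then have "gaps x \<in> short" using k stx by (auto split: if_splits)
    then have "gaps ((m + 1) # x) \<in> short"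
      using short_gapsD[of x] True by (intro short_gapsI[of _ m]) (auto simp: m'_def)
    then show ?thesis using k stx \<open>gaps x \<in> short\<close> by (simp add: keys_frag_of)
  next
    case False
    have "m \<notin> set x"
    proof
      assume "m \<in> set x"
      then have "m' \<le> m" by (simp add: m'_def)
      moreover have "m \<le> m'" using bounds sub m' by blast
      ultimately show False using False by simp
    qed
    then have "c = m" using \<open>m \<in> set v\<close> c by auto
    have "m < m'" using False bounds sub m' by force
    have less: "weight (gaps (a # x)) < weight u" if "m + 1 \<le> a" "a \<le> M" for a
      using weight_cone_less[OF c(1), of a] that c x0 \<open>c = m\<close> \<open>m < m'\<close> v
      by (simp add: m'_def M_def del: set_append)
    have "k = gaps ((m + 1) # x) \<or> gaps x \<notin> short \<and> k = gaps ((m' + 1) # x)"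
      using k stx keys_diff[of "frag_of (gaps ((m + 1) # x))" "stretch (gaps x)"]
      by (auto simp: keys_frag_of split: if_splits)
    \<comment> \<open>A long face has diameter above \<open>1\<close> and stays below
      \<open>M\<close>, so the tip chosen by \<open>stretch\<close> does not pass the maximum of
      \<open>v\<close>.\<close>
    moreover have "m' + 1 \<le> M" if "gaps x \<notin> short"
    proof (rule ccontr)
      assume "\<not> m' + 1 \<le> M"
      then have "gaps x \<in> short"
        using bounds sub x0 by (intro short_gapsI[of _ m']) (auto simp: m'_def, smt (verit) subsetD)
      with that show False by blast
    qed
    ultimately show ?thesis using less[of "m + 1"] less[of "m' + 1"] diam \<open>m < m'\<close> by auto
  qed
qed

lemma keys_bar_boundary_short:
  assumes "u \<in> short"
  shows "Poly_Mapping.keys (bar_boundary (real_subgroup \<Gamma>) (frag_of u)) \<subseteq> short"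
proof -
  obtain v where v: "gaps v = u" "length v = Suc (length u)" by (rule exists_gaps)
  then have v0: "v \<noteq> []" by auto
  have "bar_boundary (real_subgroup \<Gamma>) (frag_of u) = frag_map gaps (tuple_boundary v)"
    using bar_boundary_gaps[OF v0] v(1) by simp
  moreover have "gaps x \<in> short" if "x \<in> Poly_Mapping.keys (tuple_boundary v)" for x
  proof -
    have "set x \<subseteq> set v" using keys_tuple_boundary[OF that] by auto
    then show ?thesis using assms short_gaps_subset[of v x] v(1) by blast
  qed
  ultimately show ?thesis using keys_frag_map[of gaps "tuple_boundary v"] by auto
qed

section \<open>Pushing bar chains over \<Gamma> to tuples of diameter at most one\<close>

locale unit_subgroup =
  fixes \<Gamma> :: "real set"
  assumes zero_mem: "0 \<in> \<Gamma>" and one_mem: "1 \<in> \<Gamma>"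
    and add_mem: "x \<in> \<Gamma> \<Longrightarrow> y \<in> \<Gamma> \<Longrightarrow> x + y \<in> \<Gamma>"
    and uminus_mem: "x \<in> \<Gamma> \<Longrightarrow> - x \<in> \<Gamma>"
begin

lemma diff_mem: "x \<in> \<Gamma> \<Longrightarrow> y \<in> \<Gamma> \<Longrightarrow> x - y \<in> \<Gamma>"
  using add_mem[of x "- y"] uminus_mem[of y] by simp

abbreviation bdry :: "(real list \<Rightarrow>\<^sub>0 int) \<Rightarrow> (real list \<Rightarrow>\<^sub>0 int)" where
  "bdry \<equiv> bar_boundary (real_subgroup \<Gamma>)"

definition bar_tuples :: "nat \<Rightarrow> real list set" where
  "bar_tuples n = {u. length u = n \<and> set u \<subseteq> \<Gamma>}"

lemma gaps_bar_tuples: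
  "set v \<subseteq> \<Gamma> \<Longrightarrow> length v = Suc n \<Longrightarrow> gaps v \<in> bar_tuples n"
proof -
  have "set v \<subseteq> \<Gamma> \<Longrightarrow> set (gaps v) \<subseteq> \<Gamma>"
    by (induction v rule: gaps.induct) (auto intro: diff_mem)
  then show "set v \<subseteq> \<Gamma> \<Longrightarrow> length v = Suc n \<Longrightarrow> gaps v \<in> bar_tuples n"
    by (simp add: bar_tuples_def)
qed

lemma bar_tuplesE:
  assumes "u \<in> bar_tuples n"
  obtains v where "u = gaps v" "length v = Suc n" "set v \<subseteq> \<Gamma>"
proof -
  have "b \<in> \<Gamma> \<Longrightarrow> set u \<subseteq> \<Gamma> \<Longrightarrow> set (verts b u) \<subseteq> \<Gamma>" for b
    by (induction u arbitrary: b) (auto intro: diff_mem)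
  then show thesis
    using that[of "verts 0 u"] assms zero_mem by (auto simp: bar_tuples_def)
qed

lemma low_mem: "u \<in> bar_tuples n \<Longrightarrow> low u \<in> \<Gamma>"
proof (elim bar_tuplesE)
  fix v assume v: "u = gaps v" "length v = Suc n" "set v \<subseteq> \<Gamma>"
  then have "v \<noteq> []" by auto
  then have "Min (set v) \<in> set v" "hd v \<in> set v" by auto
  then have "Min (set v) - hd v \<in> \<Gamma>" using v(3) by (blast intro: diff_mem)
  then show ?thesis using low_gaps[OF \<open>v \<noteq> []\<close>] v(1) by simp
qed

lemma keys_bdry_bar_tuples:
  assumes "Poly_Mapping.keys z \<subseteq> bar_tuples (Suc n)"
  shows "Poly_Mapping.keys (bdry z) \<subseteq> bar_tuples n"
proof -
  have "Poly_Mapping.keys (bdry (frag_of u)) \<subseteq> bar_tuples n" if u: "u \<in> bar_tuples (Suc n)" for u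
  proof -
    obtain v where v: "u = gaps v" "length v = Suc (Suc n)" "set v \<subseteq> \<Gamma>" using u by (rule bar_tuplesE)
    have "gaps x \<in> bar_tuples n" if "x \<in> Poly_Mapping.keys (tuple_boundary v)" for x
      using keys_tuple_boundary[OF that] v by (auto intro!: gaps_bar_tuples)
    moreover have "v \<noteq> []" using v by auto
    ultimately show ?thesis
      using keys_frag_map[of gaps "tuple_boundary v"] v(1) bar_boundary_gaps[of v \<Gamma>] by auto
  qed
  with assms show ?thesis
    by (subst bar_boundary_extend) (blast dest: subsetD[OF keys_frag_extend])
qed

lemma bdry_bdry: "Poly_Mapping.keys z \<subseteq> bar_tuples (Suc n) \<Longrightarrow> bdry (bdry z) = 0"
  by (rule bar_boundary_boundary) (auto simp: bar_tuples_def)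

text \<open>As \<open>stretch\<close> vanishes on short tuples, it kills \<open>bdry z\<close>;
  subtracting \<open>bdry (frag_extend stretch z)\<close> therefore applies the operator of
  \<open>stretch_homotopy\<close> to every tuple and lowers the bound \<open>N\<close>. Only the
  boundary is required to be short, because the result serves both for cycles and for chains that
  bound a given short cycle.\<close>

lemma push_to_short:
  assumes "Poly_Mapping.keys z \<subseteq> bar_tuples n" "Poly_Mapping.keys (bdry z) \<subseteq> short"
    and "\<And>u. u \<in> Poly_Mapping.keys z \<Longrightarrow> u \<in> short \<or> weight u < N"
  shows "\<exists>w. Poly_Mapping.keys w \<subseteq> bar_tuples (Suc n) \<and> Poly_Mapping.keys (z - bdry w) \<subseteq> short"
  using assms
proof (induction N arbitrary: z)
  case 0
  then show ?case by (intro exI[of _ 0]) auto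
next
  case (Suc N)
  define w where "w = frag_extend stretch z"
  have "Poly_Mapping.keys (stretch u) \<subseteq> bar_tuples (Suc n)" if "u \<in> bar_tuples n" for u
    using that low_mem[OF that] one_mem
    by (auto simp: stretch_def keys_frag_of bar_tuples_def intro: add_mem)
  with Suc.prems(1) have w: "Poly_Mapping.keys w \<subseteq> bar_tuples (Suc n)"
    unfolding w_def using keys_frag_extend[of stretch z] by blast
  have "frag_extend stretch (bdry z) = 0"
    using Suc.prems(2) by (intro frag_extend_eq_0) (auto simp: stretch_def)
  then have "z - bdry w = frag_extend frag_of z - bdry w - frag_extend stretch (bdry z)"
    by (simp flip: frag_expansion)
  also have "\<dots> = frag_extend (\<lambda>u. frag_of u - bdry (stretch u) - frag_extend stretch (bdry (frag_of u))) z"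
    unfolding w_def by (simp add: frag_extend_fun_diff bar_boundary_def frag_extend_extend)
  finally have z': "z - bdry w = \<dots>" .
  have 1: "k \<in> short \<or> weight k < N" if "k \<in> Poly_Mapping.keys (z - bdry w)" for k
  proof -
    from that obtain u where u: "u \<in> Poly_Mapping.keys z"
      and k: "k \<in> Poly_Mapping.keys (frag_of u - bdry (stretch u) - frag_extend stretch (bdry (frag_of u)))"
      unfolding z' using keys_frag_extend by (metis (no_types, lifting) UN_E subsetD)
    show ?thesis
    proof (cases "u \<in> short")
      case True
      then have "stretch u = 0" by (simp add: stretch_def)
      moreover have "frag_extend stretch (bdry (frag_of u)) = 0"
        using keys_bar_boundary_short[OF True, of \<Gamma>]
        by (intro frag_extend_eq_0) (metis stretch_def subsetD)
      ultimately show ?thesis using k True by (simp add: keys_frag_of)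
    next
      case False
      then show ?thesis using stretch_homotopy[OF False k] Suc.prems(3)[OF u] by auto
    qed
  qed
  have 2: "Poly_Mapping.keys (z - bdry w) \<subseteq> bar_tuples n"
    using keys_bdry_bar_tuples[OF w] Suc.prems(1) keys_diff[of z "bdry w"] by blast
  have 3: "bdry (z - bdry w) = bdry z"
    using bdry_bdry[OF w] by (simp add: bar_boundary_diff)
  obtain w' where w': "Poly_Mapping.keys w' \<subseteq> bar_tuples (Suc n)"
      "Poly_Mapping.keys (z - bdry w - bdry w') \<subseteq> short"
    using Suc.IH[of "z - bdry w"] 1 2 3 Suc.prems(2) by auto
  then show ?case using w keys_add[of w w']
    by (intro exI[of _ "w + w'"]) (auto simp: bar_boundary_add diff_diff_eq)
qed

lemma short_representative:
  assumes "Poly_Mapping.keys z \<subseteq> bar_tuples n" "Poly_Mapping.keys (bdry z) \<subseteq> short"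
  obtains w where "Poly_Mapping.keys w \<subseteq> bar_tuples (Suc n)" "Poly_Mapping.keys (z - bdry w) \<subseteq> short"
proof -
  define N where "N = Suc (Max (insert 0 (weight ` Poly_Mapping.keys z)))"
  have "weight u < N" if "u \<in> Poly_Mapping.keys z" for u
    using that by (auto simp: N_def less_Suc_eq_le intro!: Max_ge)
  then show thesis using push_to_short[OF assms, of N] that by auto
qed

end

section \<open>Chains over the unit interval\<close>

text \<open>In a tuple \<open>t # cs\<close> of \<open>slots\<close> the difference tuple \<open>cs\<close> is a label of composable arrows, and
  \<open>- t\<close> is a position of the range vertex at which all vertices lie in \<open>[0, 1]\<close>.\<close>

definition slots :: "real list set" where
  "slots = {gaps (b # v) | b v. v \<noteq> [] \<and> (\<forall>x\<in>set v. b \<le> x \<and> x \<le> b + 1)}"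

lemma slotsI: "v \<noteq> [] \<Longrightarrow> (\<And>x. x \<in> set v \<Longrightarrow> b \<le> x \<and> x \<le> b + 1) \<Longrightarrow> gaps (b # v) \<in> slots"
  unfolding slots_def by blast

lemma slots_subset_short: "slots \<subseteq> short"
proof
  fix u assume "u \<in> slots"
  then obtain b v where "u = gaps (b # v)" "\<forall>x\<in>set v. b \<le> x \<and> x \<le> b + 1"
    unfolding slots_def by blast
  moreover from this have "gaps (b # v) \<in> short" by (intro short_gapsI) auto
  ultimately show "u \<in> short" by simp
qed

lemma tl_gaps: "v \<noteq> [] \<Longrightarrow> tl (gaps (b # v)) = gaps v"
  by (simp add: gaps_Cons)

text \<open>A leading \<open>0\<close> repeats the base vertex \<open>b\<close>, which lies in its
  own window \<open>[b, b + 1]\<close>.\<close>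

lemma slots_Cons_0: "u \<in> slots \<Longrightarrow> 0 # u \<in> slots"
proof -
  assume "u \<in> slots"
  then obtain b v where u: "u = gaps (b # v)" "\<forall>x\<in>set v. b \<le> x \<and> x \<le> b + 1"
    unfolding slots_def by blast
  moreover from this have "gaps (b # b # v) \<in> slots" by (intro slotsI) auto
  ultimately show ?thesis by simp
qed

lemma frag_map_frag_map [simp]: "frag_map f (frag_map g z) = frag_map (\<lambda>x. f (g x)) z"
  by (simp add: frag_extend_extend)

definition cone :: "real list \<Rightarrow> (real list \<Rightarrow>\<^sub>0 int)" where
  "cone u = frag_of (low u # u)"

section \<open>Chains over the interval as a part of the bar complex\<close>

context unit_subgroup
begin

text \<open>In \<open>0 # u\<close> the first vertex occurs twice and its two deletions cancel.
  Hence \<open>0 # y\<close> is a cycle as soon as \<open>y\<close> has zero boundary and zero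
  \<open>0\<close>-th face, while its own \<open>0\<close>-th face is \<open>y\<close>: it can
  correct \<open>0\<close>-th faces without affecting boundaries.\<close>

lemma bdry_Cons_0:
  assumes "[] \<notin> Poly_Mapping.keys y"
  shows "bdry (frag_map (Cons 0) y) = frag_map (Cons 0) (frag_map tl y - bdry y)"
proof -
  have "bdry (frag_of (0 # u)) = frag_map (Cons 0) (frag_of (tl u) - bdry (frag_of u))"
    if "u \<noteq> []" for u
  proof -
    obtain v where v: "gaps v = u" "length v = Suc (length u)" by (rule exists_gaps)
    obtain a v' where v': "v = a # v'" "length v' = length u" using v(2) by (cases v) auto
    have "v' \<noteq> []" using v'(2) that by auto
    have "0 # u = gaps (a # v)" unfolding v(1)[symmetric] v'(1) by simp
    then have "bdry (frag_of (0 # u)) = frag_map gaps (tuple_boundary (a # a # v'))"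
      using v'(1) bar_boundary_gaps[of "a # v" \<Gamma>] by simp
    moreover have "bdry (frag_of u) = frag_map gaps (tuple_boundary (a # v'))"
      using v(1) v'(1) bar_boundary_gaps[of v] by simp
    moreover have "tl u = gaps v'" using v(1) v'(1) tl_gaps[OF \<open>v' \<noteq> []\<close>] by auto
    ultimately show ?thesis by (simp add: frag_extend_diff)
  qed
  then have "frag_extend (\<lambda>u. bdry (frag_of (0 # u))) y
      = frag_extend (\<lambda>u. frag_map (Cons 0) (frag_of (tl u) - bdry (frag_of u))) y"
    using assms by (intro frag_extend_eq) metis
  then show ?thesis
    by (simp add: bar_boundary_def frag_extend_extend frag_extend_diff frag_extend_fun_diff)
qed

text \<open>The jumps of compactly supported functions on the nerve: on the sheet labelled \<open>cs\<close>, a step up at the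
  cut \<open>v\<close> is \<open>(- v) # cs\<close>. The condition on \<open>tl\<close> says that the jumps on every sheet add up to
  zero. Since \<open>tl\<close> is the \<open>0\<close>-th bar face, the bar boundary restricts to the negative of the
  nerve boundary.\<close>

definition interval_chains :: "nat \<Rightarrow> (real list \<Rightarrow>\<^sub>0 int) set" where
  "interval_chains n =
     {y. Poly_Mapping.keys y \<subseteq> bar_tuples (Suc n) \<inter> slots \<and> frag_map tl y = 0}"

text \<open>Only the \<open>0\<close>-th face deletes the base vertex and can leave
  \<open>slots\<close>. These faces add up to zero over \<open>y\<close>, so they may be subtracted
  tuple by tuple; all other faces keep the base and a subset of its window.\<close>

lemma bdry_interval_chains:
  assumes "y \<in> interval_chains (Suc n)"
  shows "bdry y \<in> interval_chains n"
proof -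
  have keys: "Poly_Mapping.keys y \<subseteq> bar_tuples (Suc (Suc n))" "Poly_Mapping.keys y \<subseteq> slots"
    and tl: "frag_map tl y = 0" using assms by (auto simp: interval_chains_def)
  have *: "Poly_Mapping.keys (bdry (frag_of u) - frag_of (tl u)) \<subseteq> slots
      \<and> frag_map tl (bdry (frag_of u)) = frag_of (tl (tl u)) - bdry (frag_of (tl u))"
    if u: "u \<in> Poly_Mapping.keys y" for u
  proof -
    from keys u obtain b v where v: "u = gaps (b # v)" "v \<noteq> []"
      and b: "\<And>x. x \<in> set v \<Longrightarrow> b \<le> x \<and> x \<le> b + 1" unfolding slots_def by blast
    have "length u = Suc (Suc n)" using keys u by (auto simp: bar_tuples_def)
    then have len: "length v = Suc (Suc n)" using v by simp
    then have ne: "[] \<notin> Poly_Mapping.keys (tuple_boundary v)"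
      by (intro nonempty_keys_tuple_boundary) simp
    have tlu: "tl u = gaps v" using v by (simp add: tl_gaps)
    have 1: "bdry (frag_of u) = frag_of (tl u) - frag_map (\<lambda>x. gaps (b # x)) (tuple_boundary v)"
      using bar_boundary_gaps[of "b # v" \<Gamma>] v tlu by (simp add: frag_extend_diff)
    have "gaps (b # x) \<in> slots" if "x \<in> Poly_Mapping.keys (tuple_boundary v)" for x
    proof -
      have "set x \<subseteq> set v" "x \<noteq> []" using keys_tuple_boundary[OF that] ne that by auto
      then show ?thesis using b by (intro slotsI) auto
    qed
    then have "Poly_Mapping.keys (bdry (frag_of u) - frag_of (tl u)) \<subseteq> slots"
      unfolding 1 using keys_frag_map[of "\<lambda>x. gaps (b # x)" "tuple_boundary v"] by auto
    moreover have "frag_map (\<lambda>x. tl (gaps (b # x))) (tuple_boundary v) = frag_map gaps (tuple_boundary v)"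
      using ne by (intro frag_extend_eq) (metis tl_gaps)
    then have "frag_map tl (bdry (frag_of u)) = frag_of (tl (tl u)) - bdry (frag_of (tl u))"
      unfolding 1 using v tlu bar_boundary_gaps[of v \<Gamma>] by (simp add: frag_extend_diff)
    ultimately show ?thesis ..
  qed
  have "bdry y = bdry y - frag_map tl y" by (simp add: tl)
  also have "\<dots> = frag_extend (\<lambda>u. bdry (frag_of u) - frag_of (tl u)) y"
    by (simp add: frag_extend_fun_diff bar_boundary_def)
  finally have "Poly_Mapping.keys (bdry y) \<subseteq> slots"
    using * keys_frag_extend by (smt (verit, ccfv_threshold) UN_E subset_iff)
  moreover have "frag_map tl (bdry y) = 0"
  proof -
    have "frag_map tl (bdry y) = frag_extend (\<lambda>u. frag_map tl (bdry (frag_of u))) y"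
      by (simp add: bar_boundary_def frag_extend_extend)
    also have "\<dots> = frag_extend (\<lambda>u. frag_of (tl (tl u)) - bdry (frag_of (tl u))) y"
      using * by (intro frag_extend_eq) auto
    also have "\<dots> = frag_map tl (frag_map tl y) - bdry (frag_map tl y)"
      by (simp add: frag_extend_fun_diff bar_boundary_def frag_extend_extend)
    finally show ?thesis by (simp add: tl)
  qed
  ultimately show ?thesis
    using keys_bdry_bar_tuples[OF keys(1)] by (simp add: interval_chains_def)
qed

text \<open>The boundary of \<open>m # v\<close> is \<open>v\<close> minus the cone with tip
  \<open>m\<close> over the boundary of \<open>v\<close>, so only that cone survives. Its tip is the
  minimum of all of \<open>v\<close>, not of the face, but still bounds every face from below with
  room \<open>1\<close>. Deleting the tip gives back the boundary of \<open>v\<close>, whence the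
  last claim.\<close>

lemma short_minus_cone:
  assumes "Poly_Mapping.keys y \<subseteq> bar_tuples (Suc n)" "Poly_Mapping.keys y \<subseteq> short"
  defines "y' \<equiv> y - bdry (frag_extend cone y)"
  shows "Poly_Mapping.keys (frag_extend cone y) \<subseteq> bar_tuples (Suc (Suc n))"
    and "Poly_Mapping.keys y' \<subseteq> bar_tuples (Suc n) \<inter> slots"
    and "frag_map tl y' = bdry y"
proof -
  have "Poly_Mapping.keys (cone u) \<subseteq> bar_tuples (Suc (Suc n))" if "u \<in> bar_tuples (Suc n)" for u
    using that low_mem[OF that] by (auto simp: cone_def bar_tuples_def)
  with assms(1) show 1: "Poly_Mapping.keys (frag_extend cone y) \<subseteq> bar_tuples (Suc (Suc n))"
    using keys_frag_extend[of cone y] by blast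
  have *: "Poly_Mapping.keys (frag_of u - bdry (cone u)) \<subseteq> slots
      \<and> frag_map tl (frag_of u - bdry (cone u)) = bdry (frag_of u)"
    if u: "u \<in> Poly_Mapping.keys y" for u
  proof -
    obtain v where v: "gaps v = u" "length v = Suc (length u)" by (rule exists_gaps)
    moreover have "length u = Suc n" using assms(1) u by (auto simp: bar_tuples_def)
    ultimately have v0: "v \<noteq> []" and "2 \<le> length v" by auto
    then have ne: "[] \<notin> Poly_Mapping.keys (tuple_boundary v)"
      by (intro nonempty_keys_tuple_boundary)
    define m where "m = Min (set v)"
    have "cone u = frag_of (gaps (m # v))"
      using low_Cons_gaps[OF v0, of 0] v(1) by (simp add: cone_def m_def)
    then have 1: "frag_of u - bdry (cone u) = frag_map (\<lambda>x. gaps (m # x)) (tuple_boundary v)"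
      using v(1) bar_boundary_gaps[of "m # v" \<Gamma>] by (simp add: frag_extend_diff)
    have "gaps (m # x) \<in> slots" if "x \<in> Poly_Mapping.keys (tuple_boundary v)" for x
    proof -
      have "set x \<subseteq> set v" "x \<noteq> []" using keys_tuple_boundary[OF that] ne that by auto
      then show ?thesis using short_gapsD[of v] assms(2) u v(1) unfolding m_def
        by (intro slotsI) blast+
    qed
    then have "Poly_Mapping.keys (frag_of u - bdry (cone u)) \<subseteq> slots"
      unfolding 1 using keys_frag_map[of "\<lambda>x. gaps (m # x)" "tuple_boundary v"] by auto
    moreover have "frag_map (\<lambda>x. tl (gaps (m # x))) (tuple_boundary v) = frag_map gaps (tuple_boundary v)"
      using ne by (intro frag_extend_eq) (metis tl_gaps)
    then have "frag_map tl (frag_of u - bdry (cone u)) = bdry (frag_of u)"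
      unfolding 1 using v bar_boundary_gaps[OF v0] by simp
    ultimately show ?thesis ..
  qed
  have y': "y' = frag_extend (\<lambda>u. frag_of u - bdry (cone u)) y"
    unfolding y'_def
    by (simp add: frag_extend_fun_diff bar_boundary_def frag_extend_extend flip: frag_expansion)
  then have "Poly_Mapping.keys y' \<subseteq> slots"
    using * keys_frag_extend by (smt (verit, ccfv_threshold) UN_E subset_iff)
  moreover have "Poly_Mapping.keys y' \<subseteq> bar_tuples (Suc n)"
    using keys_bdry_bar_tuples[OF 1] assms(1) keys_diff[of y] unfolding y'_def by blast
  ultimately show "Poly_Mapping.keys y' \<subseteq> bar_tuples (Suc n) \<inter> slots" by simp
  have "frag_map tl y' = frag_extend (\<lambda>u. bdry (frag_of u)) y"
    unfolding y' frag_extend_extend using * by (intro frag_extend_eq) auto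
  then show "frag_map tl y' = bdry y" by (simp flip: bar_boundary_extend)
qed

text \<open>The \<open>0\<close>-th face of the coned chain is the boundary of the short
  representative, so being a cycle becomes the condition that the jumps add up to zero.\<close>

lemma cycle_homologous_to_interval_chain:
  assumes z: "Poly_Mapping.keys z \<subseteq> bar_tuples (Suc n)" and "bdry z = 0"
  obtains y w where "y \<in> interval_chains n" "Poly_Mapping.keys w \<subseteq> bar_tuples (Suc (Suc n))"
    "z = y + bdry w"
proof -
  obtain w where w: "Poly_Mapping.keys w \<subseteq> bar_tuples (Suc (Suc n))"
      "Poly_Mapping.keys (z - bdry w) \<subseteq> short"
    using short_representative[OF z] assms(2) by auto
  define z' where "z' = z - bdry w"
  have z': "Poly_Mapping.keys z' \<subseteq> bar_tuples (Suc n)" "Poly_Mapping.keys z' \<subseteq> short"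
    using w keys_bdry_bar_tuples[OF w(1)] z keys_diff[of z "bdry w"] unfolding z'_def by blast+
  have "bdry z' = 0" using assms(2) bdry_bdry[OF w(1)] by (simp add: z'_def bar_boundary_diff)
  note c = short_minus_cone[OF z']
  show thesis
  proof (rule that)
    show "z' - bdry (frag_extend cone z') \<in> interval_chains n"
      using c(2,3) \<open>bdry z' = 0\<close> by (simp add: interval_chains_def)
    show "Poly_Mapping.keys (w + frag_extend cone z') \<subseteq> bar_tuples (Suc (Suc n))"
      using w(1) c(1) keys_add[of w] by blast
    show "z = z' - bdry (frag_extend cone z') + bdry (w + frag_extend cone z')"
      by (simp add: z'_def bar_boundary_add)
  qed
qed

text \<open>The bounding chain \<open>w\<close> can be shortened without altering its boundary,
  because \<open>y\<close> is already supported on short tuples.\<close>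

lemma interval_chain_boundary:
  assumes y: "y \<in> interval_chains n" "bdry y = 0"
    and w: "Poly_Mapping.keys w \<subseteq> bar_tuples (Suc (Suc n))" "y = bdry w"
  obtains y' where "y' \<in> interval_chains (Suc n)" "y = bdry y'"
proof -
  have ky: "Poly_Mapping.keys y \<subseteq> bar_tuples (Suc n)" "Poly_Mapping.keys y \<subseteq> slots"
      and tly: "frag_map tl y = 0"
    using y by (auto simp: interval_chains_def)
  obtain w1 where w1: "Poly_Mapping.keys w1 \<subseteq> bar_tuples (Suc (Suc (Suc n)))"
      "Poly_Mapping.keys (w - bdry w1) \<subseteq> short"
    using short_representative[OF w(1)] ky(2) slots_subset_short w(2) by auto
  define z where "z = w - bdry w1"
  have z: "Poly_Mapping.keys z \<subseteq> bar_tuples (Suc (Suc n))" "Poly_Mapping.keys z \<subseteq> short"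
    using w1 keys_bdry_bar_tuples[OF w1(1)] w(1) keys_diff[of w "bdry w1"] unfolding z_def by blast+
  have bz: "bdry z = y" using w(2) bdry_bdry[OF w1(1)] by (simp add: z_def bar_boundary_diff)
  note c = short_minus_cone[OF z]
  define z' where "z' = z - bdry (frag_extend cone z)"
  have bz': "bdry z' = y" using bz bdry_bdry[OF c(1)] by (simp add: z'_def bar_boundary_diff)
  \<comment> \<open>The chain \<open>z'\<close> bounds \<open>y\<close> and lies over the interval,
    but its \<open>0\<close>-th face is \<open>y\<close> instead of zero. Subtracting the cycle
    \<open>0 # y\<close>, with the same \<open>0\<close>-th face, repairs this.\<close>
  define y' where "y' = z' - frag_map (Cons 0) y"
  have "[] \<notin> Poly_Mapping.keys y" using ky by (auto simp: bar_tuples_def)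
  then have "bdry y' = y"
    by (simp add: y'_def bar_boundary_diff bz' bdry_Cons_0 tly y(2))
  moreover have "0 # u \<in> bar_tuples (Suc (Suc n)) \<inter> slots" if "u \<in> Poly_Mapping.keys y" for u
    using that ky slots_Cons_0[of u] zero_mem by (auto simp: bar_tuples_def)
  then have "Poly_Mapping.keys y' \<subseteq> bar_tuples (Suc (Suc n)) \<inter> slots"
    using c(2) keys_frag_map[of "Cons 0" y] keys_diff[of z' "frag_map (Cons 0) y"]
    unfolding y'_def z'_def by blast
  moreover have "frag_map tl y' = 0"
    using c(3) bz unfolding y'_def z'_def[symmetric]
    by (simp add: frag_extend_diff flip: frag_expansion)
  ultimately show thesis using that[of y'] by (simp add: interval_chains_def)
qed

end

section \<open>The cut line\<close>

text \<open>For \<open>v \<in> \<Gamma>\<close> this is the half line to the right of the gap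
  between \<open>Below v\<close> and \<open>Above v\<close>, which is clopen. Differences of
  indicators of such half lines are the elementary step functions.\<close>

definition exceeds :: "real \<Rightarrow> cut_point \<Rightarrow> bool" where
  "exceeds v z \<longleftrightarrow> z = Above v \<or> v < cut_proj z"

lemma cut_line_iff:
  "z \<in> cut_line \<Gamma> \<longleftrightarrow> (case z of Ordinary t \<Rightarrow> t \<notin> \<Gamma> | Below a \<Rightarrow> a \<in> \<Gamma> | Above a \<Rightarrow> a \<in> \<Gamma>)"
  by (cases z) (auto simp: cut_line_def)

lemma not_exceeds_iff:
  "v \<in> \<Gamma> \<Longrightarrow> z \<in> cut_line \<Gamma> \<Longrightarrow> \<not> exceeds v z \<longleftrightarrow> z = Below v \<or> cut_proj z < v"
  by (cases z) (auto simp: exceeds_def cut_line_iff not_less order_le_less)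

lemma exceeds_Above [simp]: "exceeds v (Above w) \<longleftrightarrow> v \<le> w"
  by (auto simp: exceeds_def)

lemma exceeds_Below [simp]: "exceeds v (Below w) \<longleftrightarrow> v < w"
  by (auto simp: exceeds_def)

lemma exceeds_antimono: "exceeds v z \<Longrightarrow> w \<le> v \<Longrightarrow> exceeds w z"
  by (auto simp: exceeds_def)

lemma topspace_cut_topology [simp]: "topspace (cut_topology \<Gamma>) = cut_line \<Gamma>"
  unfolding cut_topology_def order_topology_on_def topology_generated_by_topspace by auto

lemma openin_cut_less_left:
  "y \<in> cut_line \<Gamma> \<Longrightarrow> openin (cut_topology \<Gamma>) {z \<in> cut_line \<Gamma>. cut_less z y}"
  unfolding cut_topology_def order_topology_on_def by (rule topology_generated_by_Basis) auto

lemma openin_cut_less_right: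
  "y \<in> cut_line \<Gamma> \<Longrightarrow> openin (cut_topology \<Gamma>) {z \<in> cut_line \<Gamma>. cut_less y z}"
  unfolding cut_topology_def order_topology_on_def by (rule topology_generated_by_Basis) auto

lemma openin_exceeds:
  assumes "v \<in> \<Gamma>" shows "openin (cut_topology \<Gamma>) {z \<in> cut_line \<Gamma>. exceeds v z}"
proof -
  have "{z \<in> cut_line \<Gamma>. exceeds v z} = {z \<in> cut_line \<Gamma>. cut_less (Below v) z}"
    by (auto simp: exceeds_def cut_less_def)
  then show ?thesis using openin_cut_less_right[of "Below v" \<Gamma>] assms by (simp add: cut_line_iff)
qed

lemma openin_not_exceeds:
  assumes "v \<in> \<Gamma>" shows "openin (cut_topology \<Gamma>) {z \<in> cut_line \<Gamma>. \<not> exceeds v z}"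
proof -
  have "\<not> exceeds v z \<longleftrightarrow> cut_less z (Above v)" if "z \<in> cut_line \<Gamma>" for z
    using not_exceeds_iff[OF assms that] by (auto simp: cut_less_def)
  then have "{z \<in> cut_line \<Gamma>. \<not> exceeds v z} = {z \<in> cut_line \<Gamma>. cut_less z (Above v)}"
    by auto
  then show ?thesis using openin_cut_less_left[of "Above v" \<Gamma>] assms by (simp add: cut_line_iff)
qed

text \<open>A metric description of small neighbourhoods: two-sided at an ordinary point, one-sided
  at a doubled one. It reduces topological questions to lengths of real intervals.\<close>

definition near :: "real \<Rightarrow> cut_point \<Rightarrow> cut_point \<Rightarrow> bool" where
  "near d z w \<longleftrightarrow> \<bar>cut_proj w - cut_proj z\<bar> < d \<and>
     (case z of Ordinary _ \<Rightarrow> True | Below a \<Rightarrow> \<not> exceeds a w | Above a \<Rightarrow> exceeds a w)"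

lemma near_min [simp]: "near (min d e) z w \<longleftrightarrow> near d z w \<and> near e z w"
  by (auto simp: near_def)

lemma openin_cut_topology_near:
  assumes "openin (cut_topology \<Gamma>) U" "z \<in> U"
  shows "\<exists>d>0. \<forall>w\<in>cut_line \<Gamma>. near d z w \<longrightarrow> w \<in> U"
proof -
  let ?S = "insert (cut_line \<Gamma>) ((\<lambda>x. {z \<in> cut_line \<Gamma>. cut_less z x}) ` cut_line \<Gamma> \<union>
    (\<lambda>x. {z \<in> cut_line \<Gamma>. cut_less x z}) ` cut_line \<Gamma>)"
  have "generate_topology_on ?S U"
    using assms(1) unfolding cut_topology_def order_topology_on_def openin_topology_generated_by_iff .
  then show ?thesis using assms(2)
  proof (induction U arbitrary: z)
    case (Int A B)
    then obtain d e where "d > 0" "\<forall>w\<in>cut_line \<Gamma>. near d z w \<longrightarrow> w \<in> A"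
        "e > 0" "\<forall>w\<in>cut_line \<Gamma>. near e z w \<longrightarrow> w \<in> B" by (metis IntD1 IntD2)
    then show ?case by (intro exI[of _ "min d e"]) auto
  next
    case (UN K)
    then obtain A where A: "A \<in> K" "z \<in> A" by blast
    from UN.IH[OF A] A(1) show ?case by blast
  next
    case (Basis A)
    then consider "A = cut_line \<Gamma>"
      | y where "y \<in> cut_line \<Gamma>" "A = {z \<in> cut_line \<Gamma>. cut_less z y}"
      | y where "y \<in> cut_line \<Gamma>" "A = {z \<in> cut_line \<Gamma>. cut_less y z}" by blast
    then show ?case
    proof cases
      case 1
      then show ?thesis by (intro exI[of _ 1]) auto
    next
      case (2 y)
      with Basis have z: "z \<in> cut_line \<Gamma>" "cut_less z y" by auto
      show ?thesis
      proof (cases "cut_proj z < cut_proj y")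
        case True
        then show ?thesis using 2
          by (intro exI[of _ "cut_proj y - cut_proj z"]) (auto simp: near_def cut_less_def)
      next
        case False
        \<comment> \<open>The two points have the same projection, so no distance separates them;
          the one-sidedness of \<open>near\<close> does, and the radius is arbitrary.\<close>
        then obtain a where a: "z = Below a" "y = Above a" using z by (auto simp: cut_less_def)
        then have "a \<in> \<Gamma>" using z by (simp add: cut_line_iff)
        then show ?thesis using 2 a
          by (intro exI[of _ 1]) (auto simp: near_def cut_less_def not_exceeds_iff)
      qed
    next
      case (3 y)
      with Basis have z: "z \<in> cut_line \<Gamma>" "cut_less y z" by auto
      show ?thesis
      proof (cases "cut_proj y < cut_proj z")
        case True
        then show ?thesis using 3
          by (intro exI[of _ "cut_proj z - cut_proj y"]) (auto simp: near_def cut_less_def)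
      next
        case False
        then obtain a where a: "y = Below a" "z = Above a" using z by (auto simp: cut_less_def)
        then show ?thesis using 3 a
          by (intro exI[of _ 1]) (auto simp: near_def cut_less_def exceeds_def)
      qed
    qed
  qed auto
qed

section \<open>Segments of the cut line, studied by bisection of real intervals\<close>

definition seg :: "real set \<Rightarrow> real \<Rightarrow> real \<Rightarrow> cut_point set" where
  "seg \<Gamma> a b = {z \<in> cut_line \<Gamma>. a \<le> cut_proj z \<and> cut_proj z \<le> b \<and> z \<noteq> Below a \<and> z \<noteq> Above b}"

text \<open>An endpoint of \<open>seg\<close> outside \<open>\<Gamma>\<close> is not doubled and belongs to the segment; allowing such
  endpoints makes bisection of real intervals available.\<close>

lemma seg_eq:
  "a \<in> \<Gamma> \<Longrightarrow> b \<in> \<Gamma> \<Longrightarrow> seg \<Gamma> a b = {z \<in> cut_line \<Gamma>. exceeds a z \<and> \<not> exceeds b z}"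
  unfolding seg_def
  by (rule Collect_cong, rename_tac z, case_tac z)
     (auto simp: exceeds_def cut_line_iff order_le_less)

lemma seg_split: "z \<in> seg \<Gamma> a c \<Longrightarrow> a \<le> b \<Longrightarrow> b \<le> c \<Longrightarrow> z \<in> seg \<Gamma> a b \<or> z \<in> seg \<Gamma> b c"
  by (cases z) (auto simp: seg_def)

lemma seg_near:
  assumes "w \<in> seg \<Gamma> a b" "a \<le> x" "x \<le> b" "b - a < d"
  shows "x \<notin> \<Gamma> \<Longrightarrow> near d (Ordinary x) w" "\<not> exceeds x w \<Longrightarrow> near d (Below x) w"
    "exceeds x w \<Longrightarrow> near d (Above x) w"
  using assms by (auto simp: near_def seg_def)

text \<open>Finite covers of adjacent segments combine, and short segments around a real
  \<open>x\<close> need one member of the cover if \<open>x \<notin> \<Gamma>\<close>, or two, one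
  for each of \<open>Below x\<close> and \<open>Above x\<close>. The Bolzano principle does the
  rest.\<close>

lemma seg_finite_subcover:
  assumes "a \<le> b" and U: "\<And>U. U \<in> \<U> \<Longrightarrow> openin (cut_topology \<Gamma>) U" "cut_line \<Gamma> \<subseteq> \<Union>\<U>"
  shows "\<exists>F. finite F \<and> F \<subseteq> \<U> \<and> seg \<Gamma> a b \<subseteq> \<Union>F"
  using assms(1)
proof (induction rule: Bolzano)
  case (trans a b c)
  from trans(1) obtain F where F: "finite F" "F \<subseteq> \<U>" "seg \<Gamma> a b \<subseteq> \<Union>F" by metis
  from trans(2) obtain F' where F': "finite F'" "F' \<subseteq> \<U>" "seg \<Gamma> b c \<subseteq> \<Union>F'" by metis
  have "seg \<Gamma> a c \<subseteq> \<Union>(F \<union> F')"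
  proof
    fix z assume "z \<in> seg \<Gamma> a c"
    then have "z \<in> seg \<Gamma> a b \<or> z \<in> seg \<Gamma> b c" using trans(3,4) by (rule seg_split)
    then show "z \<in> \<Union>(F \<union> F')" using F(3) F'(3) by auto
  qed
  then show ?case using F F' by (intro exI[of _ "F \<union> F'"]) simp
next
  case (local x)
  have *: "\<exists>A d. A \<in> \<U> \<and> d > 0 \<and> (\<forall>w\<in>cut_line \<Gamma>. near d z w \<longrightarrow> w \<in> A)" if "z \<in> cut_line \<Gamma>" for z
    using that U openin_cut_topology_near[of \<Gamma> _ z] by (metis UnionE subsetD)
  show ?case
  proof (cases "x \<in> \<Gamma>")
    case False
    then obtain A d where A: "A \<in> \<U>" "d > 0" "\<forall>w\<in>cut_line \<Gamma>. near d (Ordinary x) w \<longrightarrow> w \<in> A"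
      using *[of "Ordinary x"] by (auto simp: cut_line_iff)
    have "seg \<Gamma> a b \<subseteq> \<Union>{A}" if "a \<le> x" "x \<le> b" "b - a < d" for a b
    proof
      fix w assume w: "w \<in> seg \<Gamma> a b"
      then have "w \<in> cut_line \<Gamma>" by (simp add: seg_def)
      then show "w \<in> \<Union>{A}" using A(3) seg_near(1)[OF w that False] by simp
    qed
    with A show ?thesis
      by (intro exI[of _ d] conjI allI impI exI[of _ "{A}"]) auto
  next
    case True
    then obtain A d where A: "A \<in> \<U>" "d > 0" "\<forall>w\<in>cut_line \<Gamma>. near d (Below x) w \<longrightarrow> w \<in> A"
      using *[of "Below x"] by (auto simp: cut_line_iff)
    from True obtain B e where B: "B \<in> \<U>" "e > 0" "\<forall>w\<in>cut_line \<Gamma>. near e (Above x) w \<longrightarrow> w \<in> B"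
      using *[of "Above x"] by (auto simp: cut_line_iff)
    have "seg \<Gamma> a b \<subseteq> \<Union>{A, B}" if "a \<le> x" "x \<le> b" "b - a < min d e" for a b
    proof
      fix w assume w: "w \<in> seg \<Gamma> a b"
      then have "w \<in> cut_line \<Gamma>" by (simp add: seg_def)
      then show "w \<in> \<Union>{A, B}"
        using A(3) B(3) seg_near(2,3)[OF w that(1,2)] that(3) by (cases "exceeds x w") auto
    qed
    with A B show ?thesis
      by (intro exI[of _ "min d e"] conjI allI impI exI[of _ "{A, B}"]) auto
  qed
qed

lemma compactin_seg:
  assumes "a \<in> \<Gamma>" "b \<in> \<Gamma>" "a \<le> b"
  shows "compactin (cut_topology \<Gamma>) (seg \<Gamma> a b)"
  unfolding compactin_def
proof (intro conjI allI impI)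
  show "seg \<Gamma> a b \<subseteq> topspace (cut_topology \<Gamma>)" by (auto simp: seg_def)
  fix \<U> assume \<U>: "Ball \<U> (openin (cut_topology \<Gamma>)) \<and> seg \<Gamma> a b \<subseteq> \<Union> \<U>"
  \<comment> \<open>The bisection argument starts from a cover of the whole line. The complement of
    the segment, open because the endpoints lie in \<Gamma>, is added for this purpose and discarded
    afterwards.\<close>
  let ?C = "{z \<in> cut_line \<Gamma>. \<not> exceeds a z} \<union> {z \<in> cut_line \<Gamma>. exceeds b z}"
  have C: "openin (cut_topology \<Gamma>) ?C" "?C \<inter> seg \<Gamma> a b = {}" "cut_line \<Gamma> \<subseteq> ?C \<union> seg \<Gamma> a b"
    using openin_exceeds[OF assms(2)] openin_not_exceeds[OF assms(1)] assms by (auto simp: seg_eq)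
  have "\<exists>F. finite F \<and> F \<subseteq> insert ?C \<U> \<and> seg \<Gamma> a b \<subseteq> \<Union>F"
    by (rule seg_finite_subcover) (use \<U> C assms(3) in blast)+
  then obtain F where "finite F" "F \<subseteq> insert ?C \<U>" "seg \<Gamma> a b \<subseteq> \<Union>F" by blast
  with C(2) show "\<exists>F. finite F \<and> F \<subseteq> \<U> \<and> seg \<Gamma> a b \<subseteq> \<Union>F"
    by (intro exI[of _ "F - {?C}"]) blast
qed

text \<open>Bisection again, now for the property that finitely many cuts decide the value of
  \<open>f\<close>. Near a point of \<Gamma> one cut suffices, near any other point none is
  needed.\<close>

lemma continuous_cut_finite_jumps:
  assumes f: "continuous_map (cut_topology \<Gamma>) (discrete_topology UNIV) f" and "a \<le> b"
  shows "\<exists>F. finite F \<and> F \<subseteq> \<Gamma> \<and>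
    (\<forall>z\<in>seg \<Gamma> a b. \<forall>w\<in>seg \<Gamma> a b. (\<forall>v\<in>F. exceeds v z \<longleftrightarrow> exceeds v w) \<longrightarrow> f z = f w)"
  using assms(2)
proof (induction rule: Bolzano)
  case (trans a b c)
  from trans(1) obtain F where F: "finite F" "F \<subseteq> \<Gamma>"
      "\<And>z w. z \<in> seg \<Gamma> a b \<Longrightarrow> w \<in> seg \<Gamma> a b \<Longrightarrow> (\<forall>v\<in>F. exceeds v z \<longleftrightarrow> exceeds v w) \<Longrightarrow> f z = f w"
    by blast
  from trans(2) obtain F' where F': "finite F'" "F' \<subseteq> \<Gamma>"
      "\<And>z w. z \<in> seg \<Gamma> b c \<Longrightarrow> w \<in> seg \<Gamma> b c \<Longrightarrow> (\<forall>v\<in>F'. exceeds v z \<longleftrightarrow> exceeds v w) \<Longrightarrow> f z = f w"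
    by blast
  \<comment> \<open>The point where the halves meet becomes a cut if it is doubled, and this cut
    separates the halves. Otherwise \<open>Ordinary b\<close> lies in both halves and mediates
    between them, its position relative to each cut being squeezed between those of \<open>z\<close>
    and \<open>w\<close>.\<close>
  define H where "H = F \<union> F' \<union> ({b} \<inter> \<Gamma>)"
  have cross: "f z = f w" if z: "z \<in> seg \<Gamma> a b" and w: "w \<in> seg \<Gamma> b c"
    and zw: "\<forall>v\<in>H. exceeds v z \<longleftrightarrow> exceeds v w" for z w
  proof (cases "b \<in> \<Gamma>")
    case True
    then have "exceeds b z \<longleftrightarrow> exceeds b w" using zw by (auto simp: H_def)
    then have False using z w True
      by (cases z; cases w) (auto simp: exceeds_def seg_def cut_line_iff)
    then show ?thesis ..
  next
    case False
    then have b: "Ordinary b \<in> seg \<Gamma> a b" "Ordinary b \<in> seg \<Gamma> b c"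
      using trans by (auto simp: seg_def cut_line_iff)
    have mono: "exceeds v z \<Longrightarrow> exceeds v (Ordinary b)" "exceeds v (Ordinary b) \<Longrightarrow> exceeds v w"
      if "v \<in> \<Gamma>" for v
      using z w False that by (cases z; cases w; auto simp: exceeds_def seg_def)+
    have "f z = f (Ordinary b)" using z b(1) zw mono F(2) by (intro F(3)) (auto simp: H_def)
    also have "\<dots> = f w" using w b(2) zw mono F'(2) by (intro F'(3)) (auto simp: H_def)
    finally show ?thesis .
  qed
  show ?case
  proof (intro exI[of _ H] conjI ballI impI)
    show "finite H" "H \<subseteq> \<Gamma>" using F F' by (auto simp: H_def)
    fix z w assume *: "z \<in> seg \<Gamma> a c" "w \<in> seg \<Gamma> a c" "\<forall>v\<in>H. exceeds v z \<longleftrightarrow> exceeds v w"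
    then consider "z \<in> seg \<Gamma> a b" "w \<in> seg \<Gamma> a b" | "z \<in> seg \<Gamma> b c" "w \<in> seg \<Gamma> b c"
      | "z \<in> seg \<Gamma> a b" "w \<in> seg \<Gamma> b c" | "w \<in> seg \<Gamma> a b" "z \<in> seg \<Gamma> b c"
      using seg_split[OF _ trans(3,4)] by blast
    then show "f z = f w"
    proof cases
      case 1
      then show ?thesis using *(3) by (intro F(3)) (auto simp: H_def)
    next
      case 2
      then show ?thesis using *(3) by (intro F'(3)) (auto simp: H_def)
    next
      case 3
      then show ?thesis using *(3) by (rule cross)
    next
      case 4
      then have "f w = f z" using *(3) by (intro cross) auto
      then show ?thesis by simp
    qed
  qed
next
  case (local x)
  have *: "\<exists>d>0. \<forall>w\<in>cut_line \<Gamma>. near d z w \<longrightarrow> f w = f z" if "z \<in> cut_line \<Gamma>" for z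
  proof -
    have "openin (cut_topology \<Gamma>) {w \<in> topspace (cut_topology \<Gamma>). f w \<in> {f z}}"
      using f by (rule openin_continuous_map_preimage) simp
    from openin_cut_topology_near[OF this, of z] that show ?thesis by auto
  qed
  show ?case
  proof (cases "x \<in> \<Gamma>")
    case False
    then obtain d where d: "d > 0" "\<forall>w\<in>cut_line \<Gamma>. near d (Ordinary x) w \<longrightarrow> f w = f (Ordinary x)"
      using *[of "Ordinary x"] by (auto simp: cut_line_iff)
    have "f w = f (Ordinary x)" if "a \<le> x" "x \<le> b" "b - a < d" "w \<in> seg \<Gamma> a b" for a b w
      using d that seg_near(1)[OF that(4,1-3) False] by (auto simp: seg_def)
    with d(1) show ?thesis
      by (intro exI[of _ d] conjI allI impI exI[of _ "{}"]) auto
  next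
    case True
    then obtain d where d: "d > 0" "\<forall>w\<in>cut_line \<Gamma>. near d (Below x) w \<longrightarrow> f w = f (Below x)"
      using *[of "Below x"] by (auto simp: cut_line_iff)
    from True obtain e where e: "e > 0" "\<forall>w\<in>cut_line \<Gamma>. near e (Above x) w \<longrightarrow> f w = f (Above x)"
      using *[of "Above x"] by (auto simp: cut_line_iff)
    have "f w = (if exceeds x w then f (Above x) else f (Below x))"
      if "a \<le> x" "x \<le> b" "b - a < min d e" "w \<in> seg \<Gamma> a b" for a b w
      using d e that seg_near(2,3)[OF that(4,1,2), of d] seg_near(2,3)[OF that(4,1,2), of e]
      by (auto simp: seg_def)
    then show ?thesis using d(1) e(1) True
      by (intro exI[of _ "min d e"] conjI allI impI exI[of _ "{x}"]) auto
  qed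
qed

lemma continuous_map_cut_shift:
  assumes c: "\<And>x. x + c \<in> \<Gamma> \<longleftrightarrow> x \<in> \<Gamma>"
  shows "continuous_map (cut_topology \<Gamma>) (cut_topology \<Gamma>) (cut_shift c)"
proof -
  have line: "cut_shift c z \<in> cut_line \<Gamma> \<longleftrightarrow> z \<in> cut_line \<Gamma>" for z
    by (cases z) (auto simp: cut_line_iff c)
  have c': "x - c \<in> \<Gamma> \<longleftrightarrow> x \<in> \<Gamma>" for x using c[of "x - c"] by simp
  have line': "cut_shift (- c) z \<in> cut_line \<Gamma> \<longleftrightarrow> z \<in> cut_line \<Gamma>" for z
    by (cases z) (auto simp: cut_line_iff c')
  have less: "cut_less (cut_shift c z) y \<longleftrightarrow> cut_less z (cut_shift (- c) y)"
    "cut_less y (cut_shift c z) \<longleftrightarrow> cut_less (cut_shift (- c) y) z" for y z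
    by (cases z; cases y; auto simp: cut_less_def)+
  have "openin (cut_topology \<Gamma>) (cut_shift c -` U \<inter> cut_line \<Gamma>)"
    if "U \<in> insert (cut_line \<Gamma>) ((\<lambda>x. {z \<in> cut_line \<Gamma>. cut_less z x}) ` cut_line \<Gamma> \<union>
      (\<lambda>x. {z \<in> cut_line \<Gamma>. cut_less x z}) ` cut_line \<Gamma>)" for U
  proof -
    from that consider "U = cut_line \<Gamma>"
      | y where "y \<in> cut_line \<Gamma>" "U = {z \<in> cut_line \<Gamma>. cut_less z y}"
      | y where "y \<in> cut_line \<Gamma>" "U = {z \<in> cut_line \<Gamma>. cut_less y z}" by blast
    then show ?thesis
    proof cases
      case 1
      then have "cut_shift c -` U \<inter> cut_line \<Gamma> = topspace (cut_topology \<Gamma>)" using line by auto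
      then show ?thesis by (simp only: openin_topspace)
    next
      case (2 y)
      then have "cut_shift c -` U \<inter> cut_line \<Gamma> = {z \<in> cut_line \<Gamma>. cut_less z (cut_shift (- c) y)}"
        using line less by auto
      then show ?thesis using openin_cut_less_left[of "cut_shift (- c) y" \<Gamma>] line' 2 by simp
    next
      case (3 y)
      then have "cut_shift c -` U \<inter> cut_line \<Gamma> = {z \<in> cut_line \<Gamma>. cut_less (cut_shift (- c) y) z}"
        using line less by auto
      then show ?thesis using openin_cut_less_right[of "cut_shift (- c) y" \<Gamma>] line' 3 by simp
    qed
  qed
  then have "continuous_map (cut_topology \<Gamma>) (order_topology_on (cut_line \<Gamma>) cut_less) (cut_shift c)"
    unfolding order_topology_on_def continuous_on_generated_topo_iff using line by auto
  then show ?thesis by (simp add: cut_topology_def)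
qed

text \<open>The value at \<open>z\<close> is the sum of the jumps passed on the way from the far
  left, where \<open>f\<close> vanishes. The induction walks back from \<open>z\<close> to the
  nearest cut on its left and crosses it.\<close>

lemma step_function_expansion:
  fixes f :: "cut_point \<Rightarrow> int"
  assumes f: "continuous_map (cut_topology \<Gamma>) (discrete_topology UNIV) f"
    and "a \<in> \<Gamma>" "b \<in> \<Gamma>" "a \<le> b"
    and supp: "\<And>z. z \<in> cut_line \<Gamma> \<Longrightarrow> z \<notin> seg \<Gamma> a b \<Longrightarrow> f z = 0"
  defines "J \<equiv> {v \<in> \<Gamma>. f (Above v) \<noteq> f (Below v)}"
  shows "finite J" "z \<in> cut_line \<Gamma> \<Longrightarrow> f z = (\<Sum>v\<in>{v \<in> J. exceeds v z}. f (Above v) - f (Below v))"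
proof -
  obtain F0 where F0: "finite F0" "F0 \<subseteq> \<Gamma>"
      "\<And>z w. z \<in> seg \<Gamma> a b \<Longrightarrow> w \<in> seg \<Gamma> a b \<Longrightarrow> (\<forall>v\<in>F0. exceeds v z \<longleftrightarrow> exceeds v w) \<Longrightarrow> f z = f w"
    using continuous_cut_finite_jumps[OF f \<open>a \<le> b\<close>] by metis
  \<comment> \<open>With \<open>a\<close> and \<open>b\<close> among the cuts, \<open>F\<close> also
    decides membership in the segment, so it controls \<open>f\<close> on the whole line.\<close>
  define F where "F = insert a (insert b F0)"
  have F: "finite F" "F \<subseteq> \<Gamma>" using F0 assms by (auto simp: F_def)
  have eq: "f z = f w" if zw: "z \<in> cut_line \<Gamma>" "w \<in> cut_line \<Gamma>" "\<And>v. v \<in> F \<Longrightarrow> exceeds v z \<longleftrightarrow> exceeds v w" for z w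
  proof -
    have "z \<in> seg \<Gamma> a b \<longleftrightarrow> w \<in> seg \<Gamma> a b"
      using zw assms(2,3) by (simp add: seg_eq F_def)
    then show ?thesis using F0(3)[of z w] zw supp by (cases "z \<in> seg \<Gamma> a b") (auto simp: F_def)
  qed
  have line: "Above v \<in> cut_line \<Gamma>" "Below v \<in> cut_line \<Gamma>" if "v \<in> \<Gamma>" for v
    using that by (auto simp: cut_line_iff)
  have "J \<subseteq> F"
  proof
    fix v assume v: "v \<in> J"
    show "v \<in> F"
    proof (rule ccontr)
      assume "v \<notin> F"
      then have "exceeds u (Above v) \<longleftrightarrow> exceeds u (Below v)" if "u \<in> F" for u
        using that by (cases "u = v") auto
      then show False using v eq[of "Above v" "Below v"] line by (auto simp: J_def)
    qed
  qed
  then show "finite J" using F finite_subset by blast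
  have "f z = (\<Sum>v\<in>{v \<in> F. exceeds v z}. f (Above v) - f (Below v))" if "z \<in> cut_line \<Gamma>" for z
    using that
  proof (induction "card {v \<in> F. exceeds v z}" arbitrary: z rule: less_induct)
    case less
    show ?case
    proof (cases "{v \<in> F. exceeds v z} = {}")
      case True
      then have "\<not> exceeds a z" by (auto simp: F_def)
      then have "f z = 0" using less.prems assms(2,3) by (intro supp) (auto simp: seg_eq)
      then show ?thesis unfolding True by simp
    next
      case False
      let ?V = "{v \<in> F. exceeds v z}"
      define m where "m = Max ?V"
      have m: "m \<in> ?V" unfolding m_def using F False by (intro Max_in) auto
      have le: "v \<le> m" if "v \<in> ?V" for v using F that by (simp add: m_def)
      have m': "m \<in> \<Gamma>" using m F by auto
      have V: "exceeds v z \<longleftrightarrow> v \<le> m" if "v \<in> F" for v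
        using that m le exceeds_antimono[of m z v] by auto
      have "f z = f (Above m)" using V less.prems line m' by (intro eq) auto
      moreover have VB: "{v \<in> F. exceeds v (Below m)} = ?V - {m}" using V m by auto
      have "card {v \<in> F. exceeds v (Below m)} < card ?V"
        unfolding VB using m F by (intro card_Diff1_less) auto
      then have "f (Below m) = (\<Sum>v\<in>?V - {m}. f (Above v) - f (Below v))"
        unfolding VB[symmetric]
        by (rule less.hyps) (rule line(2)[OF m'])
      moreover have "(\<Sum>v\<in>?V. f (Above v) - f (Below v)) =
          f (Above m) - f (Below m) + (\<Sum>v\<in>?V - {m}. f (Above v) - f (Below v))"
        using m F by (intro sum.remove) auto
      ultimately show ?thesis by simp
    qed
  qed
  moreover have "(\<Sum>v\<in>{v \<in> F. exceeds v z}. f (Above v) - f (Below v)) =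
      (\<Sum>v\<in>{v \<in> J. exceeds v z}. f (Above v) - f (Below v))"
    using F \<open>J \<subseteq> F\<close> by (intro sum.mono_neutral_right) (auto simp: J_def)
  ultimately show "z \<in> cut_line \<Gamma> \<Longrightarrow> f z = (\<Sum>v\<in>{v \<in> J. exceeds v z}. f (Above v) - f (Below v))"
    by simp
qed

section \<open>Points of the nerve\<close>

lemma cut_shift_shift [simp]: "cut_shift a (cut_shift b z) = cut_shift (a + b) z"
  by (cases z) (auto simp: algebra_simps)

lemma cut_shift_0 [simp]: "cut_shift 0 z = z"
  by (cases z) auto

lemma exceeds_shift [simp]: "exceeds v (cut_shift c z) \<longleftrightarrow> exceeds (v - c) z"
  by (cases z) (auto simp: exceeds_def)

lemma set_verts: "set (verts b cs) = {b - sum_list (take j cs) | j. j \<le> length cs}"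
proof (induction cs arbitrary: b)
  case (Cons c cs)
  have "{b - sum_list (take j (c # cs)) | j. j \<le> length (c # cs)}
      = insert b {b - c - sum_list (take j cs) | j. j \<le> length cs}"
    (is "?L = ?R")
  proof
    show "?L \<subseteq> ?R"
    proof
      fix w assume "w \<in> ?L"
      then obtain j where "j \<le> length (c # cs)" "w = b - sum_list (take j (c # cs))" by blast
      then show "w \<in> ?R" by (cases j) (auto simp: algebra_simps)
    qed
    show "?R \<subseteq> ?L"
    proof
      fix w assume "w \<in> ?R"
      then consider "w = b" | j where "j \<le> length cs" "w = b - c - sum_list (take j cs)" by blast
      then show "w \<in> ?L"
      proof cases
        case 1
        then show ?thesis by (auto intro!: exI[of _ 0])
      next
        case 2
        then show ?thesis by (auto intro!: exI[of _ "Suc j"])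
      qed
    qed
  qed
  then show ?case using Cons.IH[of "b - c"] by simp
qed auto

text \<open>Translating the base vertex to \<open>0\<close> turns the window into
  \<open>[0, 1]\<close>; the other vertices become \<open>- hd u\<close> minus the partial sums of
  \<open>tl u\<close>.\<close>

lemma slots_iff:
  assumes "u \<noteq> []"
  shows "u \<in> slots \<longleftrightarrow>
    (\<forall>j\<le>length (tl u). 0 \<le> - hd u - sum_list (take j (tl u)) \<and> - hd u - sum_list (take j (tl u)) \<le> 1)"
    (is "_ \<longleftrightarrow> ?R")
proof -
  have R: "?R \<longleftrightarrow> (\<forall>w\<in>set (verts (- hd u) (tl u)). 0 \<le> w \<and> w \<le> 1)"
    unfolding set_verts by auto
  show ?thesis unfolding R
  proof
    assume "u \<in> slots"
    then obtain b v where u: "u = gaps (b # v)" "v \<noteq> []" "\<forall>x\<in>set v. b \<le> x \<and> x \<le> b + 1"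
      unfolding slots_def by blast
    then have "verts (- hd u) (tl u) = map (\<lambda>x. x - b) v"
      by (simp add: gaps_Cons verts_gaps)
    then show "\<forall>w\<in>set (verts (- hd u) (tl u)). 0 \<le> w \<and> w \<le> 1" using u(3) by auto
  next
    assume *: "\<forall>w\<in>set (verts (- hd u) (tl u)). 0 \<le> w \<and> w \<le> 1"
    have "u = gaps (0 # verts (- hd u) (tl u))" using assms by (simp add: gaps_Cons)
    also have "\<dots> \<in> slots" using * by (intro slotsI) auto
    finally show "u \<in> slots" .
  qed
qed

section \<open>Pairing formal sums with integer functions, and coordinates on the nerve\<close>

definition weigh :: "('a \<Rightarrow> int) \<Rightarrow> ('a \<Rightarrow>\<^sub>0 int) \<Rightarrow> int" where
  "weigh \<phi> y = (\<Sum>u\<in>Poly_Mapping.keys y. Poly_Mapping.lookup y u * \<phi> u)"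

lemma weigh_superset:
  "finite S \<Longrightarrow> Poly_Mapping.keys y \<subseteq> S \<Longrightarrow> weigh \<phi> y = (\<Sum>u\<in>S. Poly_Mapping.lookup y u * \<phi> u)"
  unfolding weigh_def by (intro sum.mono_neutral_left) (auto simp: in_keys_iff)

lemma weigh_0 [simp]: "weigh \<phi> 0 = 0"
  by (simp add: weigh_def)

lemma weigh_frag_of [simp]: "weigh \<phi> (frag_of u) = \<phi> u"
  by (simp add: weigh_def)

lemma weigh_diff: "weigh \<phi> (y - z) = weigh \<phi> y - weigh \<phi> z"
proof -
  let ?S = "Poly_Mapping.keys y \<union> Poly_Mapping.keys z"
  show ?thesis
    using weigh_superset[of ?S y \<phi>] weigh_superset[of ?S z \<phi>] weigh_superset[of ?S "y - z" \<phi>]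
      keys_diff[of y z]
    by (simp add: lookup_minus left_diff_distrib sum_subtractf)
qed

lemma weigh_add: "weigh \<phi> (y + z) = weigh \<phi> y + weigh \<phi> z"
  using weigh_diff[of \<phi> "y + z" z] by simp

lemma weigh_frag_extend: "weigh \<phi> (frag_extend f y) = weigh (\<lambda>u. weigh \<phi> (f u)) y"
  by (induction y rule: frag_induction[OF subset_UNIV]) (auto simp: frag_extend_diff weigh_diff)

lemma weigh_cong: "(\<And>u. u \<in> Poly_Mapping.keys y \<Longrightarrow> \<phi> u = \<psi> u) \<Longrightarrow> weigh \<phi> y = weigh \<psi> y"
  by (simp add: weigh_def)

lemma weigh_cmul: "weigh \<phi> (frag_cmul c y) = c * weigh \<phi> y"
  using weigh_superset[of "Poly_Mapping.keys y" "frag_cmul c y" \<phi>] keys_cmul[of c y]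
  by (simp add: weigh_def sum_distrib_left mult.assoc)

lemma weigh_sum: "weigh \<phi> (\<Sum>i\<in>I. y i) = (\<Sum>i\<in>I. weigh \<phi> (y i))"
  by (induction I rule: infinite_finite_induct) (auto simp: weigh_add)

lemma weigh_fun_sum: "weigh (\<lambda>u. \<Sum>i\<in>I. \<phi> i u) y = (\<Sum>i\<in>I. weigh (\<phi> i) y)"
  unfolding weigh_def by (simp add: sum_distrib_left) (rule sum.swap)

lemma weigh_fun_mult: "weigh (\<lambda>u. c * \<phi> u) y = c * weigh \<phi> y"
  unfolding weigh_def by (simp add: sum_distrib_left mult.left_commute)

lemma lookup_conv_weigh: "Poly_Mapping.lookup y v = weigh (\<lambda>u. of_bool (u = v)) y"
proof -
  have "weigh (\<lambda>u. of_bool (u = v)) y = (\<Sum>u\<in>Poly_Mapping.keys y \<inter> {v}. Poly_Mapping.lookup y u)"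
    unfolding weigh_def by (subst sum.inter_restrict) (auto intro!: sum.cong)
  also have "\<dots> = Poly_Mapping.lookup y v"
    by (cases "v \<in> Poly_Mapping.keys y") (auto simp: in_keys_iff)
  finally show ?thesis by simp
qed

text \<open>Here \<open>x\<close> is the range of the first arrow, and the source of each arrow is
  reached by subtracting the labels so far. In degree zero the nerve consists of functions on one
  index whose value is a unit \<open>(0, x)\<close>; \<open>max 1\<close> and the appended
  \<open>0\<close> produce exactly this value.\<close>

definition nerve_point :: "real list \<Rightarrow> cut_point \<Rightarrow> nat \<Rightarrow> real \<times> cut_point" where
  "nerve_point cs x =
     (\<lambda>j\<in>{..<max 1 (length cs)}. ((cs @ [0]) ! j, cut_shift (- sum_list (take (Suc j) cs)) x))"

lemma nerve_point_nth:
  "j < length cs \<Longrightarrow> nerve_point cs x j = (cs ! j, cut_shift (- sum_list (take (Suc j) cs)) x)"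
  by (simp add: nerve_point_def nth_append)

text \<open>A point of the nerve is determined by the group elements of its arrows and the range of the
  first arrow; in degree zero the first arrow is the unit itself.\<close>

definition labels :: "nat \<Rightarrow> (nat \<Rightarrow> real \<times> cut_point) \<Rightarrow> real list" where
  "labels n g = map (\<lambda>j. fst (g j)) [0..<n]"

definition target :: "(nat \<Rightarrow> real \<times> cut_point) \<Rightarrow> cut_point" where
  "target g = cut_shift (fst (g 0)) (snd (g 0))"

lemma labels_nerve_point [simp]: "length cs = n \<Longrightarrow> labels n (nerve_point cs x) = cs"
  by (auto simp: labels_def nerve_point_def nth_append intro!: nth_equalityI)

lemma target_nerve_point [simp]: "target (nerve_point cs x) = x"
  by (cases cs) (auto simp: target_def nerve_point_def)

lemma nerve_point_eq_iff:
  "length cs = length ds \<Longrightarrow> nerve_point cs x = nerve_point ds z \<longleftrightarrow> cs = ds \<and> x = z"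
  by (metis labels_nerve_point target_nerve_point)

text \<open>Labels undergo the bar faces. Only the face of index zero, which drops the first arrow,
  moves the range: it becomes the source \<open>x - hd cs\<close> of the dropped arrow.\<close>

lemma nerve_face_point:
  assumes cs: "length cs = Suc n" and i: "i \<le> Suc n"
  shows "nerve_face (cut_groupoid \<Gamma>) (Suc n) i (nerve_point cs x)
    = nerve_point (bar_face (real_subgroup \<Gamma>) i cs) (if i = 0 then cut_shift (- hd cs) x else x)"
proof (cases "n = 0")
  case True
  then obtain c where "cs = [c]" using cs by (auto simp: length_Suc_conv)
  then show ?thesis using i True
    by (auto simp: nerve_face_def nerve_point_def bar_face_def cut_groupoid_def restrict_groupoid_def
        transformation_groupoid_def real_add_def fun_eq_iff restrict_def)
next
  case False
  let ?g = "nerve_point cs x"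
  have g: "?g j = (cs ! j, cut_shift (- sum_list (take (Suc j) cs)) x)" if "j \<le> n" for j
    using that cs by (simp add: nerve_point_def nth_append)
  have len: "length (bar_face (real_subgroup \<Gamma>) i cs) = n"
    using cs i by (auto simp: bar_face_def)
  have mult: "gmult (cut_groupoid \<Gamma>) (d, y) (c, z) = (d + c, z)" for d c y z
    by (simp add: cut_groupoid_def restrict_groupoid_def transformation_groupoid_def real_add_def)
  have "nerve_face (cut_groupoid \<Gamma>) (Suc n) i ?g j
      = (bar_face (real_subgroup \<Gamma>) i cs ! j,
         cut_shift (- sum_list (take (Suc j) (bar_face (real_subgroup \<Gamma>) i cs)))
           (if i = 0 then cut_shift (- hd cs) x else x))" if j: "j < n" for j
  proof -
    consider "i = 0" | "i = Suc n" | "0 < i" "i < Suc n" using i by linarith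
    then show ?thesis
    proof cases
      case 1
      obtain c ds where "cs = c # ds" using cs by (cases cs) auto
      then show ?thesis using 1 j cs False g[of "Suc j"]
        by (simp add: nerve_face_def bar_face_def algebra_simps)
    next
      case 2
      then show ?thesis using j cs False g[of j]
        by (simp add: nerve_face_def bar_face_def nth_butlast take_butlast)
    next
      case 3
      then obtain k where k: "i = Suc k" by (cases i) auto
      define p a b q where "p = take k cs" and "a = cs ! k" and "b = cs ! Suc k"
        and "q = drop (Suc (Suc k)) cs"
      have cs': "cs = p @ a # b # q"
        using 3 cs k unfolding p_def a_def b_def q_def by (simp add: Cons_nth_drop_Suc)
      have p: "length p = k" using 3 cs k by (simp add: p_def)
      have f: "bar_face (real_subgroup \<Gamma>) i cs = p @ (a + b) # q"
        using 3 cs k by (simp add: bar_face_def real_subgroup_def real_add_def p_def a_def b_def q_def)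
      consider "j < k" | "j = k" | m where "j = Suc k + m"
        by (metis Suc_leI le_Suc_ex linorder_less_linear)
      then show ?thesis
      proof cases
        case 1
        then show ?thesis using k j False g[of j] unfolding f
          by (simp add: nerve_face_def cs' p nth_append)
      next
        case 2
        then show ?thesis using k j False g[of j] g[of "Suc j"] unfolding f
          by (simp add: nerve_face_def mult) (simp add: cs' p nth_append, intro arg_cong2[where f = cut_shift], simp_all)
      next
        case (3 m)
        then show ?thesis using k j False g[of "Suc j"] unfolding f
          by (simp add: nerve_face_def cs' p nth_append numeral_3_eq_3,
              intro arg_cong2[where f = cut_shift], simp_all)
      qed
    qed
  qed
  note inside = this
  show ?thesis
  proof
    fix j
    show "nerve_face (cut_groupoid \<Gamma>) (Suc n) i ?g j = nerve_point (bar_face (real_subgroup \<Gamma>) i cs)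
        (if i = 0 then cut_shift (- hd cs) x else x) j"
    proof (cases "j < n")
      case True
      then show ?thesis by (simp only: inside nerve_point_nth len)
    next
      case False
      then show ?thesis using \<open>n \<noteq> 0\<close> len by (simp add: nerve_face_def nerve_point_def)
    qed
  qed
qed

text \<open>This index shift is the source of the sign between the two boundaries. For
  \<open>i = 0\<close> the first entry also changes, as the cut has to be seen from the source of
  the dropped arrow.\<close>

lemma tl_bar_face_Suc:
  assumes "u \<noteq> []" "tl u \<noteq> []" "i \<le> length (tl u)"
  shows "tl (bar_face (real_subgroup \<Gamma>) (Suc i) u) = bar_face (real_subgroup \<Gamma>) i (tl u)"
    and "hd (bar_face (real_subgroup \<Gamma>) (Suc i) u) = (if i = 0 then hd u + hd (tl u) else hd u)"
proof -
  obtain a b r where u: "u = a # b # r" using assms by (metis list.collapse)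
  show "tl (bar_face (real_subgroup \<Gamma>) (Suc i) u) = bar_face (real_subgroup \<Gamma>) i (tl u)"
    "hd (bar_face (real_subgroup \<Gamma>) (Suc i) u) = (if i = 0 then hd u + hd (tl u) else hd u)"
    using assms(3) by (cases i; auto simp: u bar_face_def real_subgroup_def real_add_def)+
qed

section \<open>Topology of the nerve\<close>

lemma openin_finite_all:
  assumes "finite J" "\<And>j. j \<in> J \<Longrightarrow> openin X {x \<in> topspace X. Q j x}"
  shows "openin X {x \<in> topspace X. \<forall>j\<in>J. Q j x}"
  using assms
proof (induction J)
  case (insert j J)
  then have "openin X ({x \<in> topspace X. Q j x} \<inter> {x \<in> topspace X. \<forall>j\<in>J. Q j x})"
    by (intro openin_Int) auto
  then show ?case by (simp add: Int_def conj_ac)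
qed auto

lemma openin_ex:
  assumes "\<And>j. j \<in> J \<Longrightarrow> openin X {x \<in> topspace X. Q j x}"
  shows "openin X {x \<in> topspace X. \<exists>j\<in>J. Q j x}"
proof -
  have "{x \<in> topspace X. \<exists>j\<in>J. Q j x} = (\<Union>j\<in>J. {x \<in> topspace X. Q j x})" by auto
  then show ?thesis using assms by auto
qed

lemma locally_constant_imp_continuous:
  assumes "\<And>x. x \<in> topspace X \<Longrightarrow> \<exists>V. openin X V \<and> x \<in> V \<and> (\<forall>x'\<in>V. f x' = f x)"
  shows "continuous_map X (discrete_topology UNIV) f"
  unfolding continuous_map_def
proof (intro conjI allI impI)
  fix U :: "'b set"
  show "openin X {x \<in> topspace X. f x \<in> U}"
    unfolding openin_subopen[of X "{x \<in> topspace X. f x \<in> U}"]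
  proof
    fix x assume x: "x \<in> {x \<in> topspace X. f x \<in> U}"
    then obtain V where V: "openin X V" "x \<in> V" "\<forall>x'\<in>V. f x' = f x" using assms by blast
    have "x' \<in> {x \<in> topspace X. f x \<in> U}" if "x' \<in> V" for x'
      using bspec[OF V(3) that] x subsetD[OF openin_subset[OF V(1)] that] by simp
    with V(1,2) show "\<exists>V. openin X V \<and> x \<in> V \<and> V \<subseteq> {x \<in> topspace X. f x \<in> U}"
      by blast
  qed
qed auto

section \<open>The nerve as a disjoint union of compact open sheets, one for each list of
  labels\<close>

context unit_subgroup
begin

abbreviation G where "G \<equiv> cut_groupoid \<Gamma>"

lemma cut_interval_eq: "cut_interval \<Gamma> = seg \<Gamma> 0 1"
proof -
  have "cut_le (Above 0) z \<longleftrightarrow> exceeds 0 z" for z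
    by (auto simp: cut_le_def cut_less_def exceeds_def)
  moreover have "cut_le z (Below 1) \<longleftrightarrow> \<not> exceeds 1 z" if "z \<in> cut_line \<Gamma>" for z
    unfolding not_exceeds_iff[OF one_mem that] by (auto simp: cut_le_def cut_less_def)
  ultimately show ?thesis
    unfolding seg_eq[OF zero_mem one_mem] cut_interval_def by blast
qed

lemma sum_list_mem: "set cs \<subseteq> \<Gamma> \<Longrightarrow> sum_list cs \<in> \<Gamma>"
  by (induction cs) (auto intro: add_mem zero_mem)

lemma shift_mem_iff: "c \<in> \<Gamma> \<Longrightarrow> cut_shift c z \<in> cut_line \<Gamma> \<longleftrightarrow> z \<in> cut_line \<Gamma>"
proof -
  assume c: "c \<in> \<Gamma>"
  then have "x + c \<in> \<Gamma> \<longleftrightarrow> x \<in> \<Gamma>" for x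
    using add_mem[of x c] diff_mem[of "x + c" c] by auto
  then show ?thesis by (cases z) (auto simp: cut_line_iff)
qed

lemma continuous_shift: "c \<in> \<Gamma> \<Longrightarrow> continuous_map (cut_topology \<Gamma>) (cut_topology \<Gamma>) (cut_shift c)"
  using add_mem[of _ c] diff_mem[of "_ + c" c] by (intro continuous_map_cut_shift) fastforce

text \<open>The domain of the sheet with labels \<open>cs\<close>: all units passed by the
  composable arrows must lie in the interval. The form with \<open>exceeds\<close> shows that it is
  clopen and which cuts bound it.\<close>

definition admissible :: "real list \<Rightarrow> cut_point set" where
  "admissible cs = {x \<in> cut_line \<Gamma>. \<forall>j\<in>{..length cs}.
     exceeds (sum_list (take j cs)) x \<and> \<not> exceeds (1 + sum_list (take j cs)) x}"

lemma admissible_iff: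
  assumes "set cs \<subseteq> \<Gamma>"
  shows "x \<in> admissible cs \<longleftrightarrow> x \<in> cut_line \<Gamma> \<and>
    (\<forall>j\<le>length cs. cut_shift (- sum_list (take j cs)) x \<in> cut_interval \<Gamma>)"
proof -
  have "cut_shift (- sum_list (take j cs)) x \<in> cut_interval \<Gamma> \<longleftrightarrow>
    exceeds (sum_list (take j cs)) x \<and> \<not> exceeds (1 + sum_list (take j cs)) x"
    if "x \<in> cut_line \<Gamma>" for j
  proof -
    have "sum_list (take j cs) \<in> \<Gamma>" using assms by (meson order_trans set_take_subset sum_list_mem)
    then show ?thesis using that
      by (simp add: cut_interval_eq seg_eq zero_mem one_mem shift_mem_iff uminus_mem)
  qed
  then show ?thesis by (auto simp: admissible_def)
qed

lemma topspace_arrows: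
  "topspace (arrows G) = {(c, x). c \<in> \<Gamma> \<and> x \<in> cut_line \<Gamma> \<and> x \<in> cut_interval \<Gamma> \<and> cut_shift c x \<in> cut_interval \<Gamma>}"
  by (auto simp: cut_groupoid_def restrict_groupoid_def transformation_groupoid_def real_add_def)

lemma src_G [simp]: "src G g = (0, snd g)" and rng_G [simp]: "rng G g = (0, cut_shift (fst g) (snd g))"
  by (auto simp: cut_groupoid_def restrict_groupoid_def transformation_groupoid_def real_add_def split_beta)

lemma gunits_G: "gunits G = {0} \<times> cut_interval \<Gamma>"
proof -
  have "(0, x) \<in> topspace (arrows G)" if "x \<in> cut_interval \<Gamma>" for x
    using that zero_mem by (auto simp: topspace_arrows cut_interval_def)
  then show ?thesis unfolding gunits_def
    by (force simp: topspace_arrows)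
qed

lemma nerve_point_in_nerve:
  assumes "set cs \<subseteq> \<Gamma>" "x \<in> admissible cs"
  shows "nerve_point cs x \<in> topspace (nerve G (length cs))"
proof (cases cs)
  case Nil
  then have "x \<in> cut_interval \<Gamma>" "x \<in> cut_line \<Gamma>" using assms by (auto simp: admissible_iff)
  then show ?thesis using Nil zero_mem
    by (auto simp: nerve_def nerve_point_def topspace_arrows gunits_G PiE_def)
next
  case (Cons c r)
  note x = assms(2)[unfolded admissible_iff[OF assms(1)]]
  have pt: "nerve_point cs x j \<in> topspace (arrows G)" if "j < length cs" for j
  proof -
    have c: "cs ! j \<in> \<Gamma>" using assms that by auto
    have s: "sum_list (take (Suc j) cs) = sum_list (take j cs) + cs ! j"
      using that by (simp add: take_Suc_conv_app_nth)
    then have "cut_shift (cs ! j) (cut_shift (- sum_list (take (Suc j) cs)) x) \<in> cut_interval \<Gamma>"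
      using x that by simp
    moreover have "cut_shift (- sum_list (take (Suc j) cs)) x \<in> cut_interval \<Gamma>" using x that by simp
    ultimately show ?thesis using c that
      by (simp add: nerve_point_nth topspace_arrows cut_interval_def)
  qed
  have "snd (nerve_point cs x i) = cut_shift (fst (nerve_point cs x (Suc i))) (snd (nerve_point cs x (Suc i)))"
    if "Suc i < length cs" for i
    using that by (simp add: nerve_point_nth take_Suc_conv_app_nth[of "Suc i"])
  with pt show ?thesis using Cons
    by (auto simp: nerve_def PiE_def extensional_def nerve_point_def)
qed

lemma nerve_pointE:
  assumes "g \<in> topspace (nerve G n)"
  obtains cs x where "length cs = n" "set cs \<subseteq> \<Gamma>" "x \<in> admissible cs" "g = nerve_point cs x"
proof (cases "n = 0")
  case True
  then have g: "g \<in> extensional {..<1}" "g 0 \<in> {0} \<times> cut_interval \<Gamma>" "g 0 \<in> topspace (arrows G)"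
    using assms by (auto simp: nerve_def gunits_G PiE_def)
  then obtain x where x: "g 0 = (0, x)" "x \<in> cut_interval \<Gamma>" by auto
  then have "x \<in> admissible []" by (auto simp: admissible_iff cut_interval_def)
  moreover have "g = nerve_point [] x"
    using g(1) x(1) by (auto simp: nerve_point_def fun_eq_iff extensional_def)
  ultimately show thesis using that[of "[]" x] True by simp
next
  case False
  then have g: "g \<in> extensional {..<n}" "\<And>j. j < n \<Longrightarrow> g j \<in> topspace (arrows G)"
      and comp: "\<And>i. Suc i < n \<Longrightarrow> snd (g i) = cut_shift (fst (g (Suc i))) (snd (g (Suc i)))"
    using assms by (auto simp: nerve_def PiE_def)
  define cs where "cs = labels n g"
  define x where "x = target g"
  have len: "length cs = n" and nth: "\<And>j. j < n \<Longrightarrow> cs ! j = fst (g j)"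
    by (auto simp: cs_def labels_def)
  have "fst (g j) \<in> \<Gamma>" if "j < n" for j using g(2)[OF that] by (auto simp: topspace_arrows)
  then have cs: "set cs \<subseteq> \<Gamma>" by (auto simp: cs_def labels_def)
  have snd: "snd (g j) = cut_shift (- sum_list (take (Suc j) cs)) x" if "j < n" for j
    using that
  proof (induction j)
    case 0
    then show ?case using nth[of 0] len by (cases cs) (auto simp: x_def target_def)
  next
    case (Suc j)
    then have "cut_shift (- sum_list (take (Suc (Suc j)) cs)) x
        = cut_shift (- fst (g (Suc j))) (cut_shift (- sum_list (take (Suc j) cs)) x)"
      using nth len
      by (simp add: take_Suc_conv_app_nth[of "Suc j"], intro arg_cong2[where f = cut_shift], simp_all)
    also have "\<dots> = cut_shift (- fst (g (Suc j))) (snd (g j))" using Suc by simp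
    also have "\<dots> = snd (g (Suc j))" using comp[OF Suc.prems] by simp
    finally show ?case ..
  qed
  have "g = nerve_point cs x"
  proof
    fix j show "g j = nerve_point cs x j"
    proof (cases "j < n")
      case True
      then show ?thesis using nth snd len by (simp add: nerve_point_nth prod_eq_iff)
    next
      case F: False
      then show ?thesis using g(1) False len by (simp add: nerve_point_def extensional_def)
    qed
  qed
  moreover have "x \<in> admissible cs"
    unfolding admissible_iff[OF cs]
  proof (intro conjI allI impI)
    have "x \<in> cut_interval \<Gamma>" using g(2)[of 0] False by (auto simp: topspace_arrows x_def target_def)
    then show "x \<in> cut_line \<Gamma>" by (simp add: cut_interval_def)
    fix j assume "j \<le> length cs"
    then show "cut_shift (- sum_list (take j cs)) x \<in> cut_interval \<Gamma>"
      using \<open>x \<in> cut_interval \<Gamma>\<close> g(2)[of "j - 1"] snd[of "j - 1"] len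
      by (cases j) (auto simp: topspace_arrows)
  qed
  ultimately show thesis using that len cs by blast
qed

lemma nerve_point_in_nerve_iff:
  assumes "set cs \<subseteq> \<Gamma>" "length cs = n"
  shows "nerve_point cs x \<in> topspace (nerve G n) \<longleftrightarrow> x \<in> admissible cs"
proof
  assume "nerve_point cs x \<in> topspace (nerve G n)"
  then obtain ds z where "length ds = n" "z \<in> admissible ds" "nerve_point cs x = nerve_point ds z"
    by (rule nerve_pointE)
  then show "x \<in> admissible cs" using assms by (simp add: nerve_point_eq_iff)
qed (use nerve_point_in_nerve assms in auto)

lemma labels_target_nerve:
  assumes "g \<in> topspace (nerve G n)"
  shows "g = nerve_point (labels n g) (target g)" "length (labels n g) = n" "set (labels n g) \<subseteq> \<Gamma>"
    "target g \<in> admissible (labels n g)" "target g \<in> cut_line \<Gamma>"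
  using assms by (auto elim!: nerve_pointE simp: admissible_def)

lemma openin_admissible: "set cs \<subseteq> \<Gamma> \<Longrightarrow> openin (cut_topology \<Gamma>) (admissible cs)"
  and closedin_admissible: "set cs \<subseteq> \<Gamma> \<Longrightarrow> closedin (cut_topology \<Gamma>) (admissible cs)"
proof -
  let ?X = "cut_topology \<Gamma>"
  assume cs: "set cs \<subseteq> \<Gamma>"
  have s: "sum_list (take j cs) \<in> \<Gamma>" "1 + sum_list (take j cs) \<in> \<Gamma>" for j
    using cs one_mem by (meson add_mem order_trans set_take_subset sum_list_mem)+
  have "openin ?X {x \<in> topspace ?X. exceeds (sum_list (take j cs)) x \<and> \<not> exceeds (1 + sum_list (take j cs)) x}" for j
    using openin_Int[OF openin_exceeds[OF s(1)[of j]] openin_not_exceeds[OF s(2)[of j]]]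
    by (rule back_subst[of "openin ?X"]) auto
  then have "openin ?X {x \<in> topspace ?X. \<forall>j\<in>{..length cs}.
     exceeds (sum_list (take j cs)) x \<and> \<not> exceeds (1 + sum_list (take j cs)) x}"
    by (intro openin_finite_all) auto
  then show "openin ?X (admissible cs)" by (simp add: admissible_def)
  have "openin ?X {x \<in> topspace ?X. \<not> exceeds (sum_list (take j cs)) x \<or> exceeds (1 + sum_list (take j cs)) x}" for j
    using openin_Un[OF openin_not_exceeds[OF s(1)[of j]] openin_exceeds[OF s(2)[of j]]]
    by (rule back_subst[of "openin ?X"]) auto
  then have "openin ?X {x \<in> topspace ?X. \<exists>j\<in>{..length cs}.
     \<not> exceeds (sum_list (take j cs)) x \<or> exceeds (1 + sum_list (take j cs)) x}"
    by (intro openin_ex) auto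
  moreover have "{x \<in> topspace ?X. \<exists>j\<in>{..length cs}.
     \<not> exceeds (sum_list (take j cs)) x \<or> exceeds (1 + sum_list (take j cs)) x} = topspace ?X - admissible cs"
    by (auto simp: admissible_def)
  ultimately show "closedin ?X (admissible cs)" unfolding closedin_def by (auto simp: admissible_def)
qed

lemma compactin_admissible: "set cs \<subseteq> \<Gamma> \<Longrightarrow> compactin (cut_topology \<Gamma>) (admissible cs)"
proof (rule closed_compactin[OF compactin_seg[OF zero_mem one_mem]])
  assume cs: "set cs \<subseteq> \<Gamma>"
  show "admissible cs \<subseteq> seg \<Gamma> 0 1"
    using cs by (auto simp: admissible_iff simp flip: cut_interval_eq dest!: spec[of _ 0])
qed (auto simp: closedin_admissible)

lemma continuous_nerve_arrow:
  "j < max 1 n \<Longrightarrow> continuous_map (nerve G n) (arrows G) (\<lambda>g. g j)"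
  unfolding nerve_def
  by (auto intro!: continuous_map_from_subtopology continuous_map_product_projection)

lemma arrows_G: "arrows G = subtopology (prod_topology (discrete_topology \<Gamma>) (cut_topology \<Gamma>))
    {g. snd g \<in> cut_interval \<Gamma> \<and> cut_shift (fst g) (snd g) \<in> cut_interval \<Gamma>}"
proof -
  have "{g. src G g \<in> {0} \<times> cut_interval \<Gamma> \<and> rng G g \<in> {0} \<times> cut_interval \<Gamma>}
      = {g. snd g \<in> cut_interval \<Gamma> \<and> cut_shift (fst g) (snd g) \<in> cut_interval \<Gamma>}" by auto
  then show ?thesis
    by (simp add: cut_groupoid_def restrict_groupoid_def transformation_groupoid_def real_add_def split_beta)
qed

lemma continuous_nerve_fst:
  "j < max 1 n \<Longrightarrow> continuous_map (nerve G n) (discrete_topology \<Gamma>) (\<lambda>g. fst (g j))"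
  using continuous_map_compose[OF continuous_nerve_arrow, of j n "discrete_topology \<Gamma>" fst]
  by (simp add: arrows_G o_def continuous_map_from_subtopology continuous_map_fst)

lemma continuous_nerve_snd:
  "j < max 1 n \<Longrightarrow> continuous_map (nerve G n) (cut_topology \<Gamma>) (\<lambda>g. snd (g j))"
  using continuous_map_compose[OF continuous_nerve_arrow, of j n "cut_topology \<Gamma>" snd]
  by (simp add: arrows_G o_def continuous_map_from_subtopology continuous_map_snd)

lemma openin_nerve_fst:
  assumes "j < max 1 n"
  shows "openin (nerve G n) {g \<in> topspace (nerve G n). fst (g j) = c}"
proof -
  have "openin (nerve G n) {g \<in> topspace (nerve G n). fst (g j) \<in> {c} \<inter> \<Gamma>}"
    by (rule openin_continuous_map_preimage[OF continuous_nerve_fst[OF assms]]) simp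
  moreover have "{g \<in> topspace (nerve G n). fst (g j) \<in> {c} \<inter> \<Gamma>} = {g \<in> topspace (nerve G n). fst (g j) = c}"
    using continuous_map_image_subset_topspace[OF continuous_nerve_fst[OF assms]] by auto
  ultimately show ?thesis by simp
qed

lemma openin_labels: "openin (nerve G n) {g \<in> topspace (nerve G n). labels n g = cs}"
proof (cases "length cs = n")
  case True
  have "openin (nerve G n) {g \<in> topspace (nerve G n). \<forall>j\<in>{..<n}. fst (g j) = cs ! j}"
    by (intro openin_finite_all openin_nerve_fst) auto
  moreover have "labels n g = cs \<longleftrightarrow> (\<forall>j\<in>{..<n}. fst (g j) = cs ! j)" for g
    using True by (auto simp: labels_def list_eq_iff_nth_eq)
  ultimately show ?thesis by simp
next
  case False
  then have "{g \<in> topspace (nerve G n). labels n g = cs} = {}" by (auto simp: labels_def)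
  then show ?thesis by (simp only: openin_empty)
qed

text \<open>The target is not a coordinate of the nerve, but on the open set where the first label
  is \<open>c\<close> it is the coordinate \<open>snd (g 0)\<close> shifted by
  \<open>c\<close>.\<close>

lemma openin_target:
  assumes v: "v \<in> \<Gamma>"
  shows "openin (nerve G n) {g \<in> topspace (nerve G n). exceeds v (target g) \<longleftrightarrow> b}"
proof -
  let ?N = "nerve G n"
  have 1: "openin ?N {g \<in> topspace ?N. snd (g 0) \<in> U}" if "openin (cut_topology \<Gamma>) U" for U
    by (rule openin_continuous_map_preimage[OF continuous_nerve_snd that]) simp
  have 2: "snd (g 0) \<in> cut_line \<Gamma> \<and> fst (g 0) \<in> \<Gamma>" if "g \<in> topspace ?N" for g
  proof -
    have "0 < max 1 n" by simp
    then show ?thesis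
      using that continuous_map_image_subset_topspace[OF continuous_nerve_snd, of 0 n]
        continuous_map_image_subset_topspace[OF continuous_nerve_fst, of 0 n]
      unfolding topspace_cut_topology topspace_discrete_topology by blast
  qed
  have "openin ?N {g \<in> topspace ?N. fst (g 0) = c \<and> (exceeds (v - c) (snd (g 0)) \<longleftrightarrow> b)}" if "c \<in> \<Gamma>" for c
  proof -
    have "openin (cut_topology \<Gamma>) {z \<in> cut_line \<Gamma>. exceeds (v - c) z \<longleftrightarrow> b}"
      using openin_exceeds[of "v - c" \<Gamma>] openin_not_exceeds[of "v - c" \<Gamma>] that v diff_mem
      by (cases b) auto
    from openin_Int[OF openin_nerve_fst[of 0 n c] 1[OF this]] show ?thesis
      by (rule back_subst[of "openin ?N"]) (use 2 in auto)
  qed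
  then have "openin ?N {g \<in> topspace ?N. \<exists>c\<in>\<Gamma>. fst (g 0) = c \<and> (exceeds (v - c) (snd (g 0)) \<longleftrightarrow> b)}"
    by (rule openin_ex)
  then show ?thesis
    by (rule back_subst[of "openin ?N"]) (use 2 in \<open>auto simp: target_def\<close>)
qed

lemma continuous_nerve_point:
  assumes cs: "set cs \<subseteq> \<Gamma>" and len: "length cs = n"
  shows "continuous_map (subtopology (cut_topology \<Gamma>) (admissible cs)) (nerve G n) (nerve_point cs)"
proof -
  let ?X = "subtopology (cut_topology \<Gamma>) (admissible cs)"
  have "nerve_point cs ` topspace ?X \<subseteq> topspace (nerve G n)"
    using nerve_point_in_nerve_iff[OF cs len] by auto
  then have im: "nerve_point cs \<in> topspace ?X \<rightarrow> topspace (nerve G n)" by auto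
  have comp: "continuous_map ?X (arrows G) (\<lambda>x. nerve_point cs x j)" if j: "j < max 1 n" for j
  proof -
    let ?c = "(cs @ [0]) ! j" and ?s = "- sum_list (take (Suc j) cs)"
    have c: "?c \<in> \<Gamma>" using cs zero_mem j len by (auto simp: nth_append less_Suc_eq)
    have s: "?s \<in> \<Gamma>" using cs by (meson order_trans set_take_subset sum_list_mem uminus_mem)
    have eq: "(\<lambda>x. nerve_point cs x j) = (\<lambda>x. (?c, cut_shift ?s x))"
      using j len by (simp add: nerve_point_def)
    have "continuous_map ?X (prod_topology (discrete_topology \<Gamma>) (cut_topology \<Gamma>)) (\<lambda>x. nerve_point cs x j)"
      unfolding eq using c s
      by (auto simp: continuous_map_paired intro!: continuous_map_from_subtopology continuous_shift)
    moreover have "(\<lambda>x. nerve_point cs x j) \<in> topspace ?X \<rightarrow> topspace (arrows G)"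
    proof
      fix x assume "x \<in> topspace ?X"
      then have "nerve_point cs x \<in> topspace (nerve G n)" using im by blast
      then show "nerve_point cs x j \<in> topspace (arrows G)"
        using continuous_map_funspace[OF continuous_nerve_arrow[OF j]] by blast
    qed
    ultimately show ?thesis
      unfolding arrows_G by (auto simp: continuous_map_in_subtopology)
  qed
  have "continuous_map ?X (product_topology (\<lambda>_. arrows G) {..<max 1 n}) (nerve_point cs)"
    using comp len by (auto simp: continuous_map_componentwise nerve_point_def)
  then show ?thesis using im
    unfolding nerve_def by (auto simp: continuous_map_in_subtopology split: if_splits)
qed

lemma compactin_labels:
  assumes "set cs \<subseteq> \<Gamma>" "length cs = n"
  shows "compactin (nerve G n) {g \<in> topspace (nerve G n). labels n g = cs}"
proof -
  have "compactin (subtopology (cut_topology \<Gamma>) (admissible cs)) (admissible cs)"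
    using compactin_admissible[OF assms(1)] by (simp add: compactin_subtopology)
  from image_compactin[OF this continuous_nerve_point[OF assms]]
  have "compactin (nerve G n) (nerve_point cs ` admissible cs)" .
  moreover have "nerve_point cs ` admissible cs = {g \<in> topspace (nerve G n). labels n g = cs}"
    using assms nerve_point_in_nerve_iff[OF assms] labels_target_nerve by force
  ultimately show ?thesis by simp
qed

end

section \<open>Jumps of compactly supported functions\<close>

text \<open>The first isomorphism theorem for the composite of \<open>\<phi>\<close> with the
  projection to \<open>B Mod N\<close>: its kernel is \<open>M\<close>, and it is onto even if
  \<open>\<phi>\<close> is onto only modulo \<open>N\<close>. The latter is the situation of cycles
  that can be moved over the interval only up to boundaries.\<close>

lemma FactGroup_iso_via_hom:
  assumes "group A" "comm_group B" "subgroup N B" and \<phi>: "\<phi> \<in> hom A B"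
    and M: "M = {x \<in> carrier A. \<phi> x \<in> N}"
    and surj: "\<And>y. y \<in> carrier B \<Longrightarrow> \<exists>x\<in>carrier A. \<exists>n\<in>N. y = n \<otimes>\<^bsub>B\<^esub> \<phi> x"
  shows "A Mod M \<cong> B Mod N"
proof -
  interpret B: comm_group B by fact
  interpret N: normal N B using assms(3) by (rule B.subgroup_imp_normal)
  define h where "h = (\<lambda>x. N #>\<^bsub>B\<^esub> \<phi> x)"
  have im: "\<phi> x \<in> carrier B" if "x \<in> carrier A" for x using \<phi> that by (auto simp: hom_def)
  have "h \<in> hom A (B Mod N)"
    using hom_compose[OF \<phi> N.r_coset_hom_Mod] by (simp add: h_def o_def)
  then interpret h: group_hom A "B Mod N" h
    using assms(1) N.factorgroup_is_group by (simp add: group_hom_def group_hom_axioms_def)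
  have "kernel A (B Mod N) h = M"
    unfolding M kernel_def h_def one_FactGroup
    using B.coset_join1[OF _ im assms(3)] B.coset_join2[OF im assms(3)] by blast
  moreover have "h ` carrier A = carrier (B Mod N)"
  proof
    show "h ` carrier A \<subseteq> carrier (B Mod N)" using h.homh by (auto simp: hom_def)
    show "carrier (B Mod N) \<subseteq> h ` carrier A"
    proof
      fix Y assume "Y \<in> carrier (B Mod N)"
      then obtain y where y: "y \<in> carrier B" "Y = N #>\<^bsub>B\<^esub> y" by (auto simp: carrier_FactGroup)
      from surj[OF y(1)] obtain x n where x: "x \<in> carrier A" "n \<in> N" "y = n \<otimes>\<^bsub>B\<^esub> \<phi> x" by blast
      have n: "n \<in> carrier B" using x(2) by (rule N.mem_carrier)
      have "Y = (N #>\<^bsub>B\<^esub> n) #>\<^bsub>B\<^esub> \<phi> x"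
        unfolding y(2) x(3) using B.coset_mult_assoc[OF N.subset n im[OF x(1)]] by simp
      also have "\<dots> = h x" unfolding h_def B.coset_join2[OF n assms(3) x(2)] ..
      finally show "Y \<in> h ` carrier A" using x(1) by blast
    qed
  qed
  ultimately show ?thesis using h.FactGroup_iso by simp
qed

text \<open>Paired with a chain, this adds up the jumps on the sheet \<open>cs\<close> at cuts to
  the left of \<open>x\<close>, and hence evaluates the step function at \<open>x\<close>.\<close>

definition probe :: "real list \<Rightarrow> cut_point \<Rightarrow> real list \<Rightarrow> int" where
  "probe cs x u = of_bool (tl u = cs \<and> exceeds (- hd u) x)"

context unit_subgroup
begin

definition realize :: "nat \<Rightarrow> (real list \<Rightarrow>\<^sub>0 int) \<Rightarrow> (nat \<Rightarrow> real \<times> cut_point) \<Rightarrow> int" where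
  "realize n y g =
     (if g \<in> topspace (nerve G n) then weigh (probe (labels n g) (target g)) y else 0)"

lemma realize_diff: "realize n (y - z) = (\<lambda>g. realize n y g - realize n z g)"
  by (auto simp: realize_def weigh_diff)

lemma realize_add: "realize n (y + z) = (\<lambda>g. realize n y g + realize n z g)"
  by (auto simp: realize_def weigh_add)

lemma realize_0: "realize n 0 = (\<lambda>g. 0)"
  by (auto simp: realize_def)

lemma realize_uminus: "realize n (- y) = (\<lambda>g. - realize n y g)"
  using realize_diff[of n 0 y] by (simp add: realize_0)

lemma interval_chains_diff:
  "y \<in> interval_chains n \<Longrightarrow> z \<in> interval_chains n \<Longrightarrow> y - z \<in> interval_chains n"
  using keys_diff[of y z] by (auto simp: interval_chains_def frag_extend_diff)

lemma interval_chains_0: "0 \<in> interval_chains n"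
  by (simp add: interval_chains_def)

lemma interval_chains_uminus: "y \<in> interval_chains n \<Longrightarrow> - y \<in> interval_chains n"
  using interval_chains_diff[OF interval_chains_0] by simp

lemma interval_chains_add:
  "y \<in> interval_chains n \<Longrightarrow> z \<in> interval_chains n \<Longrightarrow> y + z \<in> interval_chains n"
  using interval_chains_diff[of y n "- z"] interval_chains_uminus by simp

text \<open>A violated window condition puts \<open>x\<close> to the left of all jumps on the sheet
  or to the right of all of them. The sum is empty in one case and the total of the jumps in the
  other, which is zero by the condition on \<open>tl\<close>.\<close>

lemma weigh_probe_inadmissible:
  assumes y: "y \<in> interval_chains n" and cs: "length cs = n" "set cs \<subseteq> \<Gamma>"
    and x: "x \<in> cut_line \<Gamma>" "x \<notin> admissible cs"
  shows "weigh (probe cs x) y = 0"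
proof -
  obtain j where j: "j \<le> length cs"
      and "\<not> exceeds (sum_list (take j cs)) x \<or> exceeds (1 + sum_list (take j cs)) x"
    using x by (auto simp: admissible_def)
  then consider "\<not> exceeds (sum_list (take j cs)) x" | "exceeds (1 + sum_list (take j cs)) x" by blast
  moreover have slot: "sum_list (take j cs) \<le> - hd u \<and> - hd u \<le> 1 + sum_list (take j cs)"
    if "u \<in> Poly_Mapping.keys y" "tl u = cs" for u
  proof -
    have "u \<in> slots" "u \<noteq> []" using y that(1) by (auto simp: interval_chains_def bar_tuples_def)
    then show ?thesis using slots_iff[of u] j that(2) by force
  qed
  ultimately show ?thesis
  proof cases
    case 1
    then have "probe cs x u = 0" if "u \<in> Poly_Mapping.keys y" for u
      using slot[OF that] exceeds_antimono[of "- hd u" x] by (auto simp: probe_def)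
    then show ?thesis by (simp add: weigh_def)
  next
    case 2
    then have "probe cs x u = of_bool (tl u = cs)" if "u \<in> Poly_Mapping.keys y" for u
      using slot[OF that] exceeds_antimono[OF 2] by (auto simp: probe_def)
    then have "weigh (probe cs x) y = weigh (\<lambda>u. of_bool (tl u = cs)) y" by (rule weigh_cong)
    also have "\<dots> = Poly_Mapping.lookup (frag_map tl y) cs"
      by (simp add: lookup_conv_weigh weigh_frag_extend)
    finally show ?thesis using y by (simp add: interval_chains_def)
  qed
qed

lemma realize_nerve_point:
  assumes "y \<in> interval_chains n" "length cs = n" "set cs \<subseteq> \<Gamma>" "x \<in> cut_line \<Gamma>"
  shows "realize n y (nerve_point cs x) = weigh (probe cs x) y"
  using weigh_probe_inadmissible[OF assms] nerve_point_in_nerve_iff[OF assms(3,2)] assms(2)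
  by (auto simp: realize_def)

lemma bar_face_mem:
  assumes "length cs = Suc n" "set cs \<subseteq> \<Gamma>" "i \<le> Suc n"
  shows "length (bar_face (real_subgroup \<Gamma>) i cs) = n" "set (bar_face (real_subgroup \<Gamma>) i cs) \<subseteq> \<Gamma>"
proof -
  show "length (bar_face (real_subgroup \<Gamma>) i cs) = n" using assms by (auto simp: bar_face_def)
  have "cs ! j \<in> \<Gamma>" if "j < length cs" for j using assms that by auto
  then show "set (bar_face (real_subgroup \<Gamma>) i cs) \<subseteq> \<Gamma>"
    using assms by (auto simp: bar_face_def real_subgroup_def real_add_def
        dest: in_set_takeD in_set_dropD in_set_butlastD list.set_sel(2)[rotated] intro!: add_mem)
qed

text \<open>The fibre contains at most one point for each list \<open>cs\<close> whose face is
  \<open>ds\<close>, with target \<open>X cs\<close>. Possibly infinitely many lists occur, but only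
  the finitely many labels of \<open>y\<close>, collected in \<open>S\<close>, contribute.\<close>

lemma push_forward_realize:
  assumes y: "y \<in> interval_chains (Suc n)" and i: "i \<le> Suc n"
    and ds: "length ds = n" "set ds \<subseteq> \<Gamma>" and z: "z \<in> cut_line \<Gamma>"
  shows "push_forward (nerve G (Suc n)) (nerve_face G (Suc n) i) (realize (Suc n) y) (nerve_point ds z)
    = weigh (\<lambda>u. probe ds z (bar_face (real_subgroup \<Gamma>) (Suc i) u)) y"
proof -
  let ?f = "realize (Suc n) y" and ?N = "nerve G (Suc n)"
  define X where "X cs = (if i = 0 then cut_shift (hd cs) z else z)" for cs
  define S where "S = {cs \<in> tl ` Poly_Mapping.keys y. bar_face (real_subgroup \<Gamma>) i cs = ds}"
  define P where "P cs = nerve_point cs (X cs)" for cs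
  have key: "length u = Suc (Suc n)" "set u \<subseteq> \<Gamma>" if "u \<in> Poly_Mapping.keys y" for u
    using y that by (auto simp: interval_chains_def bar_tuples_def)
  have S: "finite S" "length cs = Suc n" "set cs \<subseteq> \<Gamma>" if "cs \<in> S" for cs
    using that key by (auto simp: S_def dest: list.set_sel(2)[rotated])
      (metis (no_types, lifting) list.sel(2) list.set_sel(2) subsetD)
  have finS: "finite S" by (simp add: S_def)
  have X: "X cs \<in> cut_line \<Gamma>" if "cs \<in> S" for cs
  proof -
    have "hd cs \<in> \<Gamma>" using S(2,3)[OF that] by (cases cs) auto
    then show ?thesis using z by (simp add: X_def shift_mem_iff)
  qed
  have face: "nerve_face G (Suc n) i (nerve_point cs x) = nerve_point ds z \<longleftrightarrow>
      bar_face (real_subgroup \<Gamma>) i cs = ds \<and> x = X cs"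
    if "length cs = Suc n" "set cs \<subseteq> \<Gamma>" for cs x
  proof -
    have "(if i = 0 then cut_shift (- hd cs) x else x) = z \<longleftrightarrow> x = X cs"
      by (auto simp: X_def)
    then show ?thesis
      using nerve_face_point[OF that(1) i] nerve_point_eq_iff bar_face_mem(1)[OF that i] ds(1) by auto
  qed
  have inj: "inj_on P S"
    using S(2) by (intro inj_onI) (auto simp: P_def nerve_point_eq_iff)
  have "(\<Sum>g | g \<in> topspace ?N \<and> nerve_face G (Suc n) i g = nerve_point ds z \<and> ?f g \<noteq> 0. ?f g)
      = sum ?f (P ` S)"
  proof (rule sum.mono_neutral_left)
    show "finite (P ` S)" using finS by simp
    show "{g. g \<in> topspace ?N \<and> nerve_face G (Suc n) i g = nerve_point ds z \<and> ?f g \<noteq> 0} \<subseteq> P ` S"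
    proof
      fix g assume g: "g \<in> {g. g \<in> topspace ?N \<and> nerve_face G (Suc n) i g = nerve_point ds z \<and> ?f g \<noteq> 0}"
      then obtain cs x where cs: "length cs = Suc n" "set cs \<subseteq> \<Gamma>" "x \<in> admissible cs" "g = nerve_point cs x"
        by (auto elim: nerve_pointE)
      then have f: "bar_face (real_subgroup \<Gamma>) i cs = ds" "x = X cs" using g face[OF cs(1,2)] by auto
      have "?f g = weigh (probe cs x) y"
        unfolding cs(4) using cs(3) by (intro realize_nerve_point[OF y cs(1,2)]) (simp add: admissible_def)
      then have "weigh (probe cs x) y \<noteq> 0" using g by simp
      then obtain u where "u \<in> Poly_Mapping.keys y" "probe cs x u \<noteq> 0"
        unfolding weigh_def by (metis (no_types, lifting) mult_zero_right sum.neutral)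
      then have "cs \<in> S" using f by (auto simp: S_def probe_def)
      then show "g \<in> P ` S" using cs f by (auto simp: P_def)
    qed
    show "\<forall>g\<in>P ` S - {g. g \<in> topspace ?N \<and> nerve_face G (Suc n) i g = nerve_point ds z \<and> ?f g \<noteq> 0}. ?f g = 0"
    proof
      fix g assume g: "g \<in> P ` S - {g. g \<in> topspace ?N \<and> nerve_face G (Suc n) i g = nerve_point ds z \<and> ?f g \<noteq> 0}"
      then obtain cs where "cs \<in> S" "g = P cs" by auto
      then have "nerve_face G (Suc n) i g = nerve_point ds z"
        using face[OF S(2,3)] by (auto simp: S_def P_def)
      then show "?f g = 0" using g by (auto simp: realize_def)
    qed
  qed
  also have "\<dots> = (\<Sum>cs\<in>S. weigh (probe cs (X cs)) y)"
    unfolding sum.reindex[OF inj] o_def P_def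
    using S(2,3) X by (intro sum.cong realize_nerve_point[OF y]) auto
  also have "\<dots> = weigh (\<lambda>u. \<Sum>cs\<in>S. probe cs (X cs) u) y"
    by (simp add: weigh_fun_sum)
  also have "\<dots> = weigh (\<lambda>u. probe ds z (bar_face (real_subgroup \<Gamma>) (Suc i) u)) y"
  proof (rule weigh_cong)
    fix u assume u: "u \<in> Poly_Mapping.keys y"
    \<comment> \<open>After the exchange of sums a tuple \<open>u\<close> meets only its own sheet
      \<open>tl u\<close>; the shift in \<open>X\<close> accounts for the changed first entry of the
      bar face.\<close>
    have "(\<Sum>cs\<in>S. probe cs (X cs) u) = (\<Sum>cs\<in>S \<inter> {tl u}. probe cs (X cs) u)"
      using finS by (intro sum.mono_neutral_right) (auto simp: probe_def)
    also have "\<dots> = of_bool (tl u \<in> S \<and> exceeds (- hd u) (X (tl u)))"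
      by (cases "tl u \<in> S") (auto simp: probe_def)
    also have "\<dots> = probe ds z (bar_face (real_subgroup \<Gamma>) (Suc i) u)"
    proof -
      have "u \<noteq> []" "tl u \<noteq> []" "i \<le> length (tl u)" using key(1)[OF u] i by (auto simp flip: length_0_conv)
      note f = tl_bar_face_Suc[OF this]
      have "exceeds (- hd u) (X (tl u)) \<longleftrightarrow> exceeds (- hd (bar_face (real_subgroup \<Gamma>) (Suc i) u)) z"
        unfolding f(2) X_def by (simp add: algebra_simps)
      then show ?thesis unfolding probe_def f(1) using u by (simp add: S_def)
    qed
    finally show "(\<Sum>cs\<in>S. probe cs (X cs) u) = probe ds z (bar_face (real_subgroup \<Gamma>) (Suc i) u)" .
  qed
  finally show ?thesis by (simp add: push_forward_def)
qed

text \<open>The nerve face of index \<open>i\<close> matches the bar face of index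
  \<open>i + 1\<close>, which reverses all signs, and the remaining bar face of index zero
  contributes nothing on interval chains.\<close>

lemma nerve_boundary_realize:
  assumes y: "y \<in> interval_chains (Suc n)"
  shows "nerve_boundary G (Suc n) (realize (Suc n) y) = (\<lambda>h. - realize n (bdry y) h)"
proof
  fix h
  let ?R = "real_subgroup \<Gamma>"
  show "nerve_boundary G (Suc n) (realize (Suc n) y) h = - realize n (bdry y) h"
  proof (cases "\<exists>ds z. length ds = n \<and> set ds \<subseteq> \<Gamma> \<and> z \<in> cut_line \<Gamma> \<and> h = nerve_point ds z")
    case True
    then obtain ds z where ds: "length ds = n" "set ds \<subseteq> \<Gamma>" "z \<in> cut_line \<Gamma>" and h: "h = nerve_point ds z"
      by blast
    have len: "length u = Suc (Suc n)" if "u \<in> Poly_Mapping.keys y" for u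
      using y that by (auto simp: interval_chains_def bar_tuples_def)
    have tl: "weigh (\<lambda>u. probe ds z (tl u)) y = 0"
      using y weigh_frag_extend[of "probe ds z" "\<lambda>u. frag_of (tl u)" y]
      by (simp add: interval_chains_def)
    have "realize n (bdry y) h = weigh (probe ds z) (bdry y)"
      unfolding h by (rule realize_nerve_point[OF bdry_interval_chains[OF y] ds])
    also have "\<dots> = weigh (\<lambda>u. \<Sum>i\<le>length u. (-1) ^ i * probe ds z (bar_face ?R i u)) y"
      by (simp add: bar_boundary_def weigh_frag_extend weigh_sum weigh_cmul)
    also have "\<dots> = weigh (\<lambda>u. \<Sum>i\<le>Suc (Suc n). (-1) ^ i * probe ds z (bar_face ?R i u)) y"
      by (rule weigh_cong) (simp only: len)
    also have "\<dots> = (\<Sum>i\<le>Suc (Suc n). (-1) ^ i * weigh (\<lambda>u. probe ds z (bar_face ?R i u)) y)"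
      by (simp only: weigh_fun_sum weigh_fun_mult)
    also have "\<dots> = - (\<Sum>i\<le>Suc n. (-1) ^ i * weigh (\<lambda>u. probe ds z (bar_face ?R (Suc i) u)) y)"
      by (subst sum.atMost_Suc_shift) (simp add: bar_face_def[of ?R 0] tl sum_negf del: sum.atMost_Suc)
    finally show ?thesis
      unfolding nerve_boundary_def h using push_forward_realize[OF y _ ds] by simp
  next
    case False
    have "push_forward (nerve G (Suc n)) (nerve_face G (Suc n) i) (realize (Suc n) y) h = 0"
      if i: "i \<le> Suc n" for i
    proof -
      have "nerve_face G (Suc n) i g \<noteq> h" if "g \<in> topspace (nerve G (Suc n))" for g
      proof -
        obtain cs x where cs: "length cs = Suc n" "set cs \<subseteq> \<Gamma>" "x \<in> admissible cs" "g = nerve_point cs x"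
          using \<open>g \<in> _\<close> by (rule nerve_pointE)
        have "hd cs \<in> \<Gamma>" using cs(1,2) by (cases cs) auto
        then have "(if i = 0 then cut_shift (- hd cs) x else x) \<in> cut_line \<Gamma>"
          using cs(3) by (simp add: admissible_def shift_mem_iff uminus_mem)
        with False bar_face_mem[OF cs(1,2) i] show ?thesis
          unfolding cs(4) nerve_face_point[OF cs(1) i] by blast
      qed
      then have "{g. g \<in> topspace (nerve G (Suc n)) \<and> nerve_face G (Suc n) i g = h \<and> realize (Suc n) y g \<noteq> 0} = {}"
        by blast
      then show ?thesis unfolding push_forward_def by (simp only: sum.empty)
    qed
    moreover have "realize n (bdry y) h = 0"
      using False labels_target_nerve[of h n] unfolding realize_def by metis
    ultimately show ?thesis by (simp add: nerve_boundary_def)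
  qed
qed

text \<open>The coefficient of \<open>a # cs\<close> is recovered as the difference of the values at
  the two points over the cut \<open>- a\<close> on the sheet \<open>cs\<close>.\<close>

lemma realize_injective:
  assumes y: "y \<in> interval_chains n" and "realize n y = (\<lambda>_. 0)"
  shows "y = 0"
proof (rule poly_mapping_eqI)
  fix u
  show "Poly_Mapping.lookup y u = Poly_Mapping.lookup 0 u"
  proof (cases "u \<in> bar_tuples (Suc n)")
    case False
    then show ?thesis using y by (auto simp: interval_chains_def in_keys_iff)
  next
    case True
    then obtain a cs where u: "u = a # cs" "length cs = n" "a \<in> \<Gamma>" "set cs \<subseteq> \<Gamma>"
      by (cases u) (auto simp: bar_tuples_def)
    have 0: "weigh (probe cs x) y = 0" if "x \<in> cut_line \<Gamma>" for x
      using realize_nerve_point[OF y u(2,4) that] assms(2) by simp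
    have "Above (- a) \<in> cut_line \<Gamma>" "Below (- a) \<in> cut_line \<Gamma>"
      using uminus_mem[OF u(3)] by (auto simp: cut_line_iff)
    then have "0 = weigh (probe cs (Above (- a))) y - weigh (probe cs (Below (- a))) y"
      by (simp add: 0)
    also have "\<dots> = weigh (\<lambda>u. probe cs (Above (- a)) u - probe cs (Below (- a)) u) y"
      by (simp add: weigh_def right_diff_distrib sum_subtractf)
    also have "\<dots> = weigh (\<lambda>v. of_bool (v = u)) y"
    proof (rule weigh_cong)
      fix v assume "v \<in> Poly_Mapping.keys y"
      then have "v \<noteq> []" using y by (auto simp: interval_chains_def bar_tuples_def)
      then show "probe cs (Above (- a)) v - probe cs (Below (- a)) v = of_bool (v = u)"
        by (cases v) (auto simp: probe_def u(1))
    qed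
    finally show ?thesis by (simp add: lookup_conv_weigh)
  qed
qed

text \<open>The labels and the position relative to the finitely many cuts of \<open>y\<close>
  determine the value, and these data are locally constant. The support is closed and meets only
  finitely many sheets, each of them compact.\<close>

lemma realize_in_Cc:
  assumes y: "y \<in> interval_chains n"
  shows "realize n y \<in> carrier (Cc (nerve G n))"
proof -
  let ?N = "nerve G n" and ?f = "realize n y"
  have key: "- hd u \<in> \<Gamma>" "length (tl u) = n" "set (tl u) \<subseteq> \<Gamma>" if "u \<in> Poly_Mapping.keys y" for u
  proof -
    have "u \<in> bar_tuples (Suc n)" using y that by (auto simp: interval_chains_def)
    then show "- hd u \<in> \<Gamma>" "length (tl u) = n" "set (tl u) \<subseteq> \<Gamma>"
      by (cases u; auto simp: bar_tuples_def intro: uminus_mem)+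
  qed
  have cont: "continuous_map ?N (discrete_topology UNIV) ?f"
  proof (rule locally_constant_imp_continuous)
    fix g assume g: "g \<in> topspace ?N"
    let ?V = "{h \<in> topspace ?N. labels n h = labels n g} \<inter>
      {h \<in> topspace ?N. \<forall>u\<in>Poly_Mapping.keys y. exceeds (- hd u) (target h) \<longleftrightarrow> exceeds (- hd u) (target g)}"
    have "openin ?N ?V"
      using key by (intro openin_Int openin_labels openin_finite_all openin_target) auto
    moreover have "?f h = ?f g" if "h \<in> ?V" for h
      using that g unfolding realize_def by (auto simp: probe_def intro!: weigh_cong)
    ultimately show "\<exists>V. openin ?N V \<and> g \<in> V \<and> (\<forall>h\<in>V. ?f h = ?f g)"
      using g by (intro exI[of _ ?V]) blast
  qed
  let ?S = "{g \<in> topspace ?N. ?f g \<noteq> 0}"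
  have "closedin ?N {g \<in> topspace ?N. ?f g \<in> - {0}}"
    by (rule closedin_continuous_map_preimage[OF cont]) simp
  then have closed: "closedin ?N ?S" by simp
  have "compactin ?N (\<Union>cs\<in>tl ` Poly_Mapping.keys y. {g \<in> topspace ?N. labels n g = cs})"
  proof (rule compactin_Union)
    fix S assume "S \<in> (\<lambda>cs. {g \<in> topspace ?N. labels n g = cs}) ` tl ` Poly_Mapping.keys y"
    then obtain u where "u \<in> Poly_Mapping.keys y" "S = {g \<in> topspace ?N. labels n g = tl u}" by blast
    then show "compactin ?N S" using compactin_labels key(2,3) by blast
  qed simp
  moreover have "?S \<subseteq> (\<Union>cs\<in>tl ` Poly_Mapping.keys y. {g \<in> topspace ?N. labels n g = cs})"
  proof
    fix g assume g: "g \<in> ?S"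
    then have "weigh (probe (labels n g) (target g)) y \<noteq> 0" by (auto simp: realize_def)
    then obtain u where "u \<in> Poly_Mapping.keys y" "probe (labels n g) (target g) u \<noteq> 0"
      unfolding weigh_def by (metis (no_types, lifting) mult_zero_right sum.neutral)
    then have "labels n g \<in> tl ` Poly_Mapping.keys y"
      by (intro image_eqI[of _ _ u]) (auto simp: probe_def split: if_splits)
    then show "g \<in> (\<Union>cs\<in>tl ` Poly_Mapping.keys y. {g \<in> topspace ?N. labels n g = cs})"
      using g by blast
  qed
  ultimately have "compactin ?N ?S" using closed by (rule closed_compactin)
  then show ?thesis
    using cont closure_of_closedin[OF closed] by (simp add: Cc_def realize_def)
qed

lemma Cc_fibre_continuous:
  assumes f: "f \<in> carrier (Cc (nerve G n))" and cs: "set cs \<subseteq> \<Gamma>" "length cs = n"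
  shows "continuous_map (cut_topology \<Gamma>) (discrete_topology UNIV) (\<lambda>x. f (nerve_point cs x))"
    and "x \<notin> admissible cs \<Longrightarrow> f (nerve_point cs x) = 0"
proof -
  let ?X = "cut_topology \<Gamma>"
  show out: "f (nerve_point cs x) = 0" if "x \<notin> admissible cs" for x
    using that f nerve_point_in_nerve_iff[OF cs] by (auto simp: Cc_def)
  have "continuous_map (nerve G n) (discrete_topology UNIV) f" using f by (simp add: Cc_def)
  from continuous_map_compose[OF continuous_nerve_point[OF cs] this]
  have cont: "continuous_map (subtopology ?X (admissible cs)) (discrete_topology UNIV) (\<lambda>x. f (nerve_point cs x))"
    by (simp add: o_def)
  show "continuous_map ?X (discrete_topology UNIV) (\<lambda>x. f (nerve_point cs x))"
  proof (rule locally_constant_imp_continuous)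
    fix x assume x: "x \<in> topspace ?X"
    show "\<exists>V. openin ?X V \<and> x \<in> V \<and> (\<forall>x'\<in>V. f (nerve_point cs x') = f (nerve_point cs x))"
    proof (cases "x \<in> admissible cs")
      case True
      let ?V = "{x' \<in> topspace (subtopology ?X (admissible cs)). f (nerve_point cs x') \<in> {f (nerve_point cs x)}}"
      have "openin (subtopology ?X (admissible cs)) ?V"
        by (rule openin_continuous_map_preimage[OF cont]) simp
      then have "openin ?X ?V" using openin_admissible[OF cs(1)] by (rule openin_trans_full)
      then show ?thesis using x True by (intro exI[of _ ?V]) auto
    next
      case False
      then show ?thesis using closedin_admissible[OF cs(1)] x out
        by (intro exI[of _ "topspace ?X - admissible cs"]) (auto simp: closedin_def)
    qed
  qed
qed

text \<open>The sheets are open and cover the nerve, so finitely many of them cover the compact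
  closure of the support.\<close>

lemma Cc_finite_labels:
  assumes f: "f \<in> carrier (Cc (nerve G n))"
  shows "finite (labels n ` {g \<in> topspace (nerve G n). f g \<noteq> 0})"
proof -
  let ?N = "nerve G n" and ?S = "{g \<in> topspace (nerve G n). f g \<noteq> 0}"
  let ?U = "(\<lambda>cs. {g \<in> topspace ?N. labels n g = cs}) ` UNIV"
  have sub: "?S \<subseteq> ?N closure_of ?S" by (rule closure_of_subset) auto
  have compact: "compactin ?N (?N closure_of ?S)" using f by (simp add: Cc_def)
  have "\<exists>F. finite F \<and> F \<subseteq> ?U \<and> ?N closure_of ?S \<subseteq> \<Union>F"
  proof (rule compactinD[OF compact])
    show "openin ?N U" if "U \<in> ?U" for U using that openin_labels by auto
    show "?N closure_of ?S \<subseteq> \<Union>?U" using closure_of_subset_topspace[of ?N ?S] by auto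
  qed
  then obtain F where F: "finite F" "F \<subseteq> ?U" "?N closure_of ?S \<subseteq> \<Union>F" by blast
  from finite_subset_image[OF F(1,2)] obtain L
    where L: "finite L" "F = (\<lambda>cs. {g \<in> topspace ?N. labels n g = cs}) ` L" by blast
  then have "labels n ` ?S \<subseteq> L" using F(3) sub by auto
  then show ?thesis using L(1) finite_subset by blast
qed

lemma realize_surjective:
  assumes f: "f \<in> carrier (Cc (nerve G n))"
  obtains y where "y \<in> interval_chains n" "f = realize n y"
proof -
  define jump where "jump u = (if u \<in> bar_tuples (Suc n)
      then f (nerve_point (tl u) (Above (- hd u))) - f (nerve_point (tl u) (Below (- hd u))) else 0)" for u
  define J where "J cs = {v \<in> \<Gamma>. f (nerve_point cs (Above v)) \<noteq> f (nerve_point cs (Below v))}" for cs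
  have line: "Above v \<in> cut_line \<Gamma>" "Below v \<in> cut_line \<Gamma>" if "v \<in> \<Gamma>" for v
    using that by (auto simp: cut_line_iff)
  \<comment> \<open>At a jump one of the two adjacent values is nonzero, so one side is admissible.
    Either side yields the weak inequalities, and cuts at the ends of the windows do occur.\<close>
  have adm: "v \<in> \<Gamma> \<and> (\<forall>j\<le>length cs. sum_list (take j cs) \<le> v \<and> v \<le> 1 + sum_list (take j cs))"
    if "v \<in> J cs" "set cs \<subseteq> \<Gamma>" "length cs = n" for v cs
  proof -
    have "f (nerve_point cs (Above v)) \<noteq> 0 \<or> f (nerve_point cs (Below v)) \<noteq> 0"
      using that(1) by (auto simp: J_def)
    then have "Above v \<in> admissible cs \<or> Below v \<in> admissible cs"
      using Cc_fibre_continuous(2)[OF f that(2,3)] by blast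
    then have "sum_list (take j cs) \<le> v \<and> v \<le> 1 + sum_list (take j cs)" if "j \<le> length cs" for j
      using that by (auto simp: admissible_def dest!: bspec[of _ _ j])
    then show ?thesis using that(1) by (auto simp: J_def)
  qed
  have expand: "finite (J cs)"
    "x \<in> cut_line \<Gamma> \<Longrightarrow> f (nerve_point cs x) =
      (\<Sum>v\<in>{v \<in> J cs. exceeds v x}. f (nerve_point cs (Above v)) - f (nerve_point cs (Below v)))"
    if cs: "set cs \<subseteq> \<Gamma>" "length cs = n" for cs x
  proof -
    have supp: "f (nerve_point cs z) = 0" if "z \<in> cut_line \<Gamma>" "z \<notin> seg \<Gamma> 0 1" for z
    proof (rule Cc_fibre_continuous(2)[OF f cs])
      show "z \<notin> admissible cs"
        using that cs by (auto simp: admissible_iff simp flip: cut_interval_eq dest!: spec[of _ 0])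
    qed
    note * = step_function_expansion[OF Cc_fibre_continuous(1)[OF f cs] zero_mem one_mem zero_le_one supp]
    show "finite (J cs)" using *(1) by (simp add: J_def)
    show "x \<in> cut_line \<Gamma> \<Longrightarrow> f (nerve_point cs x) =
      (\<Sum>v\<in>{v \<in> J cs. exceeds v x}. f (nerve_point cs (Above v)) - f (nerve_point cs (Below v)))"
      using *(2) by (simp add: J_def)
  qed
  let ?L = "labels n ` {g \<in> topspace (nerve G n). f g \<noteq> 0}"
  have L: "set cs \<subseteq> \<Gamma> \<and> length cs = n" if "cs \<in> ?L" for cs
    using that labels_target_nerve(2,3) by blast
  have jumpD: "\<exists>v cs. u = (- v) # cs \<and> v \<in> J cs \<and> cs \<in> ?L" if u: "jump u \<noteq> 0" for u
  proof -
    have "u \<in> bar_tuples (Suc n)" using u by (auto simp: jump_def split: if_splits)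
    then obtain a cs where c: "u = a # cs" "a \<in> \<Gamma>" "set cs \<subseteq> \<Gamma>" "length cs = n"
      by (cases u) (auto simp: bar_tuples_def)
    have v: "- a \<in> J cs" using u c uminus_mem[OF c(2)] by (auto simp: jump_def J_def split: if_splits)
    then obtain x where x: "f (nerve_point cs x) \<noteq> 0" by (auto simp: J_def) metis
    then have "x \<in> admissible cs" using Cc_fibre_continuous(2)[OF f c(3,4)] by blast
    then have "nerve_point cs x \<in> topspace (nerve G n)" using nerve_point_in_nerve_iff[OF c(3,4)] by blast
    then have "labels n (nerve_point cs x) \<in> ?L" using x by blast
    then show ?thesis using v c by (intro exI[of _ "- a"] exI[of _ cs]) auto
  qed
  have "finite (\<Union>cs\<in>?L. (\<lambda>v. (- v) # cs) ` J cs)"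
    using Cc_finite_labels[OF f] expand(1) L by blast
  then have fin: "finite {u. jump u \<noteq> 0}"
    by (rule rev_finite_subset) (use jumpD in blast)
  define y where "y = Abs_poly_mapping jump"
  have lookup: "Poly_Mapping.lookup y = jump" unfolding y_def using fin by (rule lookup_Abs_poly_mapping)
  have keys: "Poly_Mapping.keys y = {u. jump u \<noteq> 0}" by (auto simp: in_keys_iff lookup)
  have bar: "Poly_Mapping.keys y \<subseteq> bar_tuples (Suc n)" by (auto simp: keys jump_def split: if_splits)
  have eval: "weigh (probe cs x) y = f (nerve_point cs x)"
    if cs: "set cs \<subseteq> \<Gamma>" "length cs = n" and x: "x \<in> cut_line \<Gamma>" for cs x
  proof -
    let ?I = "{v \<in> J cs. exceeds v x}"
    have j: "jump ((- v) # cs) = f (nerve_point cs (Above v)) - f (nerve_point cs (Below v))"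
      if "v \<in> J cs" for v
      using that cs uminus_mem by (auto simp: jump_def bar_tuples_def J_def)
    have "weigh (probe cs x) y = (\<Sum>u\<in>(\<lambda>v. (- v) # cs) ` ?I. jump u)"
      unfolding weigh_def lookup
    proof (rule sum.mono_neutral_cong_right)
      show "finite (Poly_Mapping.keys y)" by simp
      show "(\<lambda>v. (- v) # cs) ` ?I \<subseteq> Poly_Mapping.keys y" using j by (auto simp: keys J_def)
      show "\<forall>u\<in>Poly_Mapping.keys y - (\<lambda>v. (- v) # cs) ` ?I. jump u * probe cs x u = 0"
        using jumpD by (fastforce simp: keys probe_def)
      show "jump u * probe cs x u = jump u" if "u \<in> (\<lambda>v. (- v) # cs) ` ?I" for u
        using that by (auto simp: probe_def)
    qed
    also have "\<dots> = (\<Sum>v\<in>?I. f (nerve_point cs (Above v)) - f (nerve_point cs (Below v)))"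
      by (subst sum.reindex) (auto simp: inj_on_def j)
    also have "\<dots> = f (nerve_point cs x)" using expand(2)[OF cs x] by simp
    finally show ?thesis .
  qed
  have slot: "u \<in> slots \<and> - hd u \<le> 1" if u: "u \<in> Poly_Mapping.keys y" for u
  proof -
    have "jump u \<noteq> 0" using u by (simp add: keys)
    from jumpD[OF this] obtain v cs where v: "u = (- v) # cs" "v \<in> J cs" "cs \<in> ?L" by blast
    note a = adm[OF v(2)] L[OF v(3)]
    then show ?thesis using v(1) slots_iff[of u] by (auto simp: algebra_simps dest: spec[of _ 0])
  qed
  have "Poly_Mapping.lookup (frag_map tl y) cs = 0" for cs
  proof (cases "set cs \<subseteq> \<Gamma> \<and> length cs = n")
    case True
    \<comment> \<open>All cuts are at most \<open>1\<close>, so at the point \<open>Above 2\<close>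
      every jump has been passed and the value is their total; this point is outside the interval,
      where \<open>f\<close> vanishes.\<close>
    have two: "Above 2 \<in> cut_line \<Gamma>" using add_mem[OF one_mem one_mem] by (simp add: cut_line_iff)
    have "Poly_Mapping.lookup (frag_map tl y) cs = weigh (\<lambda>u. of_bool (tl u = cs)) y"
      by (simp add: lookup_conv_weigh weigh_frag_extend)
    also have "\<dots> = weigh (probe cs (Above 2)) y"
      using slot by (intro weigh_cong) (force simp: probe_def)
    also have "\<dots> = f (nerve_point cs (Above 2))" using True two by (intro eval) auto
    also have "\<dots> = 0"
      using True by (intro Cc_fibre_continuous(2)[OF f]) (auto simp: admissible_def intro!: bexI[of _ 0])
    finally show ?thesis .
  next
    case False
    then have "cs \<notin> tl ` Poly_Mapping.keys y"
    proof (rule contrapos_nn)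
      assume "cs \<in> tl ` Poly_Mapping.keys y"
      then obtain u where "u \<in> bar_tuples (Suc n)" "cs = tl u" using bar by blast
      then show "set cs \<subseteq> \<Gamma> \<and> length cs = n" by (cases u) (auto simp: bar_tuples_def)
    qed
    then have "cs \<notin> Poly_Mapping.keys (frag_map tl y)" using keys_frag_map[of tl y] by blast
    then show ?thesis by (simp add: in_keys_iff)
  qed
  then have "frag_map tl y = 0" by (intro poly_mapping_eqI) simp
  then have y: "y \<in> interval_chains n" using bar slot by (auto simp: interval_chains_def)
  moreover have "f g = realize n y g" for g
  proof (cases "g \<in> topspace (nerve G n)")
    case True
    note g = labels_target_nerve[OF True]
    show ?thesis using eval[OF g(3,2,5)] g(1) True by (simp add: realize_def)
  next
    case False
    then show ?thesis using f by (simp add: realize_def Cc_def)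
  qed
  ultimately show thesis using that by blast
qed

end

section \<open>The isomorphism in homology\<close>

context unit_subgroup
begin

lemma bar_chains_carrier:
  "carrier (bar_chains (real_add\<lparr>carrier := \<Gamma>\<rparr>) n) = {z. Poly_Mapping.keys z \<subseteq> bar_tuples n}"
  by (rule Set.set_eqI) (simp add: bar_chains_def bar_tuples_def)

lemma realize_inj_on: "inj_on (realize n) (interval_chains n)"
proof (rule inj_onI)
  fix y z assume "y \<in> interval_chains n" "z \<in> interval_chains n" "realize n y = realize n z"
  then show "y = z"
    using realize_injective[of "y - z" n] interval_chains_diff by (simp add: realize_diff)
qed

lemma carrier_Cc_nerve: "carrier (Cc (nerve G n)) = realize n ` interval_chains n"
  using realize_in_Cc by (auto elim: realize_surjective)

text \<open>Both faces of a bar tuple of length one are empty and cancel, in accordance with all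
  chains of degree zero being cycles on the groupoid side.\<close>

lemma bdry_interval_chains_0: "y \<in> interval_chains 0 \<Longrightarrow> bdry y = 0"
proof -
  assume "y \<in> interval_chains 0"
  then have "Poly_Mapping.keys y \<subseteq> bar_tuples (Suc 0)" by (auto simp: interval_chains_def)
  moreover have "bdry (frag_of u) = 0" if u: "u \<in> bar_tuples (Suc 0)" for u
  proof -
    obtain t where "u = [t]" using u by (auto simp: bar_tuples_def length_Suc_conv)
    then show ?thesis by (simp add: bar_boundary_def bar_face_def)
  qed
  ultimately show ?thesis
    by (subst bar_boundary_extend) (rule frag_extend_eq_0, blast)
qed

definition interval_cycles :: "nat \<Rightarrow> (real list \<Rightarrow>\<^sub>0 int) set" where
  "interval_cycles k = {y \<in> interval_chains k. bdry y = 0}"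

lemma cycles_Cc_nerve: "cycles (\<lambda>n. Cc (nerve G n)) (nerve_boundary G) k = realize k ` interval_cycles k"
proof (cases k)
  case 0
  then show ?thesis
    by (auto simp: cycles_def carrier_Cc_nerve interval_cycles_def bdry_interval_chains_0)
next
  case (Suc n)
  have "nerve_boundary G (Suc n) (realize (Suc n) y) = (\<lambda>_. 0) \<longleftrightarrow> bdry y = 0"
    if y: "y \<in> interval_chains (Suc n)" for y
    using realize_injective[OF bdry_interval_chains[OF y]]
    by (auto simp: nerve_boundary_realize[OF y] realize_0 fun_eq_iff)
  moreover have "monoid.one (Cc (nerve G n)) = (\<lambda>_. 0)" by (simp add: Cc_def)
  ultimately show ?thesis
    by (auto simp: cycles_def kernel_def Suc carrier_Cc_nerve interval_cycles_def)
qed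

text \<open>The sign between the two boundaries is absorbed by replacing \<open>y\<close> with
  \<open>- y\<close>.\<close>

lemma boundaries_Cc_nerve:
  "nerve_boundary G (Suc k) ` carrier (Cc (nerve G (Suc k))) = realize k ` bdry ` interval_chains (Suc k)"
proof -
  have *: "nerve_boundary G (Suc k) (realize (Suc k) y) = realize k (bdry (- y))"
    if "y \<in> interval_chains (Suc k)" for y
    by (simp add: nerve_boundary_realize[OF that] bar_boundary_uminus realize_uminus)
  show ?thesis
  proof
    show "nerve_boundary G (Suc k) ` carrier (Cc (nerve G (Suc k))) \<subseteq> realize k ` bdry ` interval_chains (Suc k)"
      using * interval_chains_uminus by (auto simp: carrier_Cc_nerve)
    show "realize k ` bdry ` interval_chains (Suc k) \<subseteq> nerve_boundary G (Suc k) ` carrier (Cc (nerve G (Suc k)))"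
    proof clarify
      fix y assume y: "y \<in> interval_chains (Suc k)"
      then have "realize k (bdry y) = nerve_boundary G (Suc k) (realize (Suc k) (- y))"
        using *[OF interval_chains_uminus[OF y]] by simp
      then show "realize k (bdry y) \<in> nerve_boundary G (Suc k) ` carrier (Cc (nerve G (Suc k)))"
        using interval_chains_uminus[OF y] by (auto simp: carrier_Cc_nerve)
    qed
  qed
qed

lemma cycles_bar_chains:
  "cycles (bar_chains (real_add\<lparr>carrier := \<Gamma>\<rparr>)) (\<lambda>_. bdry) (Suc k)
    = {z. Poly_Mapping.keys z \<subseteq> bar_tuples (Suc k) \<and> bdry z = 0}"
  by (auto simp: cycles_def kernel_def bar_chains_carrier) (auto simp: bar_chains_def)

lemma homology_iso:
  "groupoid_homology (cut_groupoid \<Gamma>) k \<cong> group_homology (real_add\<lparr>carrier := \<Gamma>\<rparr>) (Suc k)"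
proof -
  let ?C = "\<lambda>n. Cc (nerve G n)" and ?B = "bar_chains (real_add\<lparr>carrier := \<Gamma>\<rparr>)"
  let ?X = "cycles ?C (nerve_boundary G) k" and ?Y = "cycles ?B (\<lambda>_. bdry) (Suc k)"
  let ?N = "bdry ` carrier (?B (Suc (Suc k)))"
  note Xeq = cycles_Cc_nerve[of k] and Yeq = cycles_bar_chains[of k]
  have cyc: "interval_cycles k \<subseteq> interval_chains k" by (auto simp: interval_cycles_def)
  have cyc_add: "y + z \<in> interval_cycles k" if "y \<in> interval_cycles k" "z \<in> interval_cycles k" for y z
    using that by (auto simp: interval_cycles_def interval_chains_add bar_boundary_add)
  have cyc_uminus: "- y \<in> interval_cycles k" if "y \<in> interval_cycles k" for y
    using that by (auto simp: interval_cycles_def interval_chains_uminus bar_boundary_uminus)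
  have cyc_0: "0 \<in> interval_cycles k" by (simp add: interval_cycles_def interval_chains_0)
  \<comment> \<open>The map that records jumps. It is additive on cycles because
    \<open>realize\<close> is, and its values are bar cycles one degree higher.\<close>
  define \<phi> where "\<phi> = inv_into (interval_chains k) (realize k)"
  have \<phi>: "\<phi> (realize k y) = y" if "y \<in> interval_chains k" for y
    unfolding \<phi>_def using realize_inj_on that by (rule inv_into_f_f)
  have A: "group ((?C k)\<lparr>carrier := ?X\<rparr>)" (is "group ?A")
  proof -
    have mult: "f \<otimes>\<^bsub>?A\<^esub> g = (\<lambda>x. f x + g x)" and one: "\<one>\<^bsub>?A\<^esub> = (\<lambda>_. 0)"
      and carr: "carrier ?A = realize k ` interval_cycles k" for f g
      by (simp_all add: Xeq) (simp_all add: Cc_def)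
    show ?thesis
    proof (rule groupI, unfold mult one carr)
      show "(\<lambda>_. 0) \<in> realize k ` interval_cycles k"
        using cyc_0 by (intro image_eqI[of _ _ 0]) (auto simp: realize_0)
    next
      fix f g assume "f \<in> realize k ` interval_cycles k" "g \<in> realize k ` interval_cycles k"
      then obtain y z where "f = realize k y" "g = realize k z" "y \<in> interval_cycles k" "z \<in> interval_cycles k"
        by blast
      then show "(\<lambda>x. f x + g x) \<in> realize k ` interval_cycles k"
        using cyc_add by (intro image_eqI[of _ _ "y + z"]) (auto simp: realize_add)
    next
      fix f assume "f \<in> realize k ` interval_cycles k"
      then obtain y where y: "f = realize k y" "y \<in> interval_cycles k" by blast
      show "\<exists>g\<in>realize k ` interval_cycles k. (\<lambda>x. g x + f x) = (\<lambda>_. 0)"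
      proof (rule bexI)
        show "(\<lambda>x. realize k (- y) x + f x) = (\<lambda>_. 0)" by (simp add: y(1) realize_uminus)
        show "realize k (- y) \<in> realize k ` interval_cycles k" using cyc_uminus[OF y(2)] by blast
      qed
    qed (simp_all add: add.assoc)
  qed
  have B: "comm_group ((?B (Suc k))\<lparr>carrier := ?Y\<rparr>)"
  proof (rule comm_groupI; simp add: Yeq bar_chains_def)
    show "\<exists>w. Poly_Mapping.keys w \<subseteq> bar_tuples (Suc k) \<and> bdry w = 0 \<and> w + z = 0"
      if "Poly_Mapping.keys z \<subseteq> bar_tuples (Suc k) \<and> bdry z = 0" for z
      using that by (intro exI[of _ "- z"]) (auto simp: bar_boundary_uminus)
    show "Poly_Mapping.keys (y + z) \<subseteq> bar_tuples (Suc k) \<and> bdry (y + z) = 0"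
      if "Poly_Mapping.keys y \<subseteq> bar_tuples (Suc k) \<and> bdry y = 0"
        "Poly_Mapping.keys z \<subseteq> bar_tuples (Suc k) \<and> bdry z = 0" for y z
      using that keys_add[of y z] by (auto simp: bar_boundary_add)
  qed
  have N_sub: "?N \<subseteq> ?Y"
    using keys_bdry_bar_tuples bdry_bdry by (auto simp: Yeq bar_chains_carrier)
  have N: "subgroup ?N ((?B (Suc k))\<lparr>carrier := ?Y\<rparr>)"
  proof (rule group.subgroupI)
    show "group ((?B (Suc k))\<lparr>carrier := ?Y\<rparr>)" using B by (simp add: comm_group_def)
    then interpret Bg: group "(?B (Suc k))\<lparr>carrier := ?Y\<rparr>" .
    show "?N \<subseteq> carrier ((?B (Suc k))\<lparr>carrier := ?Y\<rparr>)" using N_sub by simp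
    have "0 \<in> carrier (?B (Suc (Suc k)))" by (simp add: bar_chains_carrier)
    then show "?N \<noteq> {}" by blast
    fix a assume a: "a \<in> ?N"
    then obtain w where w: "Poly_Mapping.keys w \<subseteq> bar_tuples (Suc (Suc k))" "a = bdry w"
      by (auto simp: bar_chains_carrier)
    have neg: "- a = bdry (- w)" using w(2) by (simp add: bar_boundary_uminus)
    then have mem: "- a \<in> ?N" using w(1) by (auto simp: bar_chains_carrier)
    have "inv\<^bsub>(?B (Suc k))\<lparr>carrier := ?Y\<rparr>\<^esub> a = - a"
      by (rule Bg.inv_equality) (use a mem N_sub in \<open>auto simp: bar_chains_def\<close>)
    then show "inv\<^bsub>(?B (Suc k))\<lparr>carrier := ?Y\<rparr>\<^esub> a \<in> ?N" using mem by simp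
    fix b assume "b \<in> ?N"
    then obtain w' where w': "Poly_Mapping.keys w' \<subseteq> bar_tuples (Suc (Suc k))" "b = bdry w'"
      by (auto simp: bar_chains_carrier)
    have "w + w' \<in> carrier (?B (Suc (Suc k)))"
      using w(1) w'(1) keys_add[of w w'] by (auto simp: bar_chains_carrier)
    moreover have "a \<otimes>\<^bsub>(?B (Suc k))\<lparr>carrier := ?Y\<rparr>\<^esub> b = bdry (w + w')"
      using w w' by (simp add: bar_boundary_add bar_chains_def)
    ultimately show "a \<otimes>\<^bsub>(?B (Suc k))\<lparr>carrier := ?Y\<rparr>\<^esub> b \<in> ?N" by blast
  qed
  have "((?C k)\<lparr>carrier := ?X\<rparr>) Mod (nerve_boundary G (Suc k) ` carrier (?C (Suc k)))
      \<cong> ((?B (Suc k))\<lparr>carrier := ?Y\<rparr>) Mod ?N"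
  proof (rule FactGroup_iso_via_hom[OF A B N])
    show "\<phi> \<in> hom ((?C k)\<lparr>carrier := ?X\<rparr>) ((?B (Suc k))\<lparr>carrier := ?Y\<rparr>)"
    proof (rule homI)
      fix f assume "f \<in> carrier ((?C k)\<lparr>carrier := ?X\<rparr>)"
      then obtain y where y: "y \<in> interval_cycles k" "f = realize k y" by (auto simp: Xeq)
      then show "\<phi> f \<in> carrier ((?B (Suc k))\<lparr>carrier := ?Y\<rparr>)"
        using \<phi>[of y] by (auto simp: Yeq interval_cycles_def interval_chains_def)
      fix g assume "g \<in> carrier ((?C k)\<lparr>carrier := ?X\<rparr>)"
      then obtain z where z: "z \<in> interval_cycles k" "g = realize k z" by (auto simp: Xeq)
      have mult: "f \<otimes>\<^bsub>(?C k)\<lparr>carrier := ?X\<rparr>\<^esub> g = realize k (y + z)"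
        using y z by (simp add: Cc_def realize_add)
      have "y \<in> interval_chains k" "z \<in> interval_chains k" "y + z \<in> interval_chains k"
        using y(1) z(1) cyc_add cyc by blast+
      then have "\<phi> f = y" "\<phi> g = z" "\<phi> (realize k (y + z)) = y + z"
        unfolding y(2) z(2) by (blast intro: \<phi>)+
      then show "\<phi> (f \<otimes>\<^bsub>(?C k)\<lparr>carrier := ?X\<rparr>\<^esub> g) = \<phi> f \<otimes>\<^bsub>(?B (Suc k))\<lparr>carrier := ?Y\<rparr>\<^esub> \<phi> g"
        unfolding mult by (simp add: bar_chains_def)
    qed
    \<comment> \<open>Injectivity in homology: an interval cycle that bounds in the bar complex
      bounds among the interval chains.\<close>
    have mem_iff: "y \<in> bdry ` interval_chains (Suc k) \<longleftrightarrow> y \<in> ?N" if "y \<in> interval_cycles k" for y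
    proof
      assume "y \<in> bdry ` interval_chains (Suc k)"
      then show "y \<in> ?N" by (auto simp: bar_chains_carrier interval_chains_def)
    next
      assume "y \<in> ?N"
      then obtain w where "Poly_Mapping.keys w \<subseteq> bar_tuples (Suc (Suc k))" "y = bdry w"
        by (auto simp: bar_chains_carrier)
      then show "y \<in> bdry ` interval_chains (Suc k)"
        using interval_chain_boundary[of y k w] that by (auto simp: interval_cycles_def)
    qed
    have sub: "bdry ` interval_chains (Suc k) \<subseteq> interval_cycles k"
      using bdry_interval_chains bdry_bdry by (auto simp: interval_cycles_def interval_chains_def)
    have "realize k ` bdry ` interval_chains (Suc k) = {f \<in> realize k ` interval_cycles k. \<phi> f \<in> ?N}"
    proof (intro equalityI subsetI)
      fix f assume "f \<in> realize k ` bdry ` interval_chains (Suc k)"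
      then obtain y where y: "f = realize k y" "y \<in> bdry ` interval_chains (Suc k)" by blast
      then have "y \<in> interval_cycles k" "\<phi> f = y" using sub cyc \<phi> by blast+
      then show "f \<in> {f \<in> realize k ` interval_cycles k. \<phi> f \<in> ?N}"
        using y mem_iff[of y] by blast
    next
      fix f assume f: "f \<in> {f \<in> realize k ` interval_cycles k. \<phi> f \<in> ?N}"
      then obtain y where y: "f = realize k y" "y \<in> interval_cycles k" by blast
      then have "\<phi> f = y" using cyc \<phi> by blast
      then show "f \<in> realize k ` bdry ` interval_chains (Suc k)"
        using f y mem_iff[of y] by blast
    qed
    then show "nerve_boundary G (Suc k) ` carrier (?C (Suc k))
        = {f \<in> carrier ((?C k)\<lparr>carrier := ?X\<rparr>). \<phi> f \<in> ?N}"
      by (simp add: boundaries_Cc_nerve Xeq)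
    \<comment> \<open>Surjectivity in homology: each bar cycle is an interval cycle up to a
      boundary.\<close>
    fix z assume "z \<in> carrier ((?B (Suc k))\<lparr>carrier := ?Y\<rparr>)"
    then have z: "Poly_Mapping.keys z \<subseteq> bar_tuples (Suc k)" "bdry z = 0" by (auto simp: Yeq)
    then obtain y w where y: "y \<in> interval_chains k"
      and w: "Poly_Mapping.keys w \<subseteq> bar_tuples (Suc (Suc k))" "z = y + bdry w"
      by (rule cycle_homologous_to_interval_chain)
    have "bdry y = 0" using z(2) w bdry_bdry[OF w(1)] by (simp add: bar_boundary_add)
    then have "realize k y \<in> carrier ((?C k)\<lparr>carrier := ?X\<rparr>)"
      using y by (auto simp: Xeq interval_cycles_def)
    moreover have "bdry w \<in> ?N" using w(1) by (auto simp: bar_chains_carrier)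
    moreover have "z = bdry w \<otimes>\<^bsub>(?B (Suc k))\<lparr>carrier := ?Y\<rparr>\<^esub> \<phi> (realize k y)"
      using w(2) \<phi>[OF y] by (simp add: bar_chains_def add.commute)
    ultimately show "\<exists>f\<in>carrier ((?C k)\<lparr>carrier := ?X\<rparr>). \<exists>n\<in>?N.
        z = n \<otimes>\<^bsub>(?B (Suc k))\<lparr>carrier := ?Y\<rparr>\<^esub> \<phi> f" by blast
  qed
  then show ?thesis
    by (simp add: groupoid_homology_def group_homology_def complex_homology_def real_subgroup_def)
qed

end

theorem theorem6:
  fixes \<Gamma> :: "real set"
  assumes "subgroup \<Gamma> real_add"
    and "countable \<Gamma>"
    and "closure \<Gamma> = UNIV"
    and "1 \<in> \<Gamma>"
  shows "\<forall>k::nat. groupoid_homology (cut_groupoid \<Gamma>) k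
                 \<cong> group_homology (real_add\<lparr>carrier := \<Gamma>\<rparr>) (k + 1)"
proof -
  interpret S: subgroup \<Gamma> real_add by fact
  have "group real_add"
    by (rule groupI) (auto simp: real_add_def intro: exI[of _ "- _"])
  then interpret R: group real_add .
  have inv: "inv\<^bsub>real_add\<^esub> x = - x" for x
    by (rule R.inv_equality) (auto simp: real_add_def)
  interpret unit_subgroup \<Gamma>
  proof
    show "0 \<in> \<Gamma>" using S.one_closed by (simp add: real_add_def)
    show "1 \<in> \<Gamma>" by fact
    show "x + y \<in> \<Gamma>" if "x \<in> \<Gamma>" "y \<in> \<Gamma>" for x y
      using S.m_closed[OF that] by (simp add: real_add_def)
    show "- x \<in> \<Gamma>" if "x \<in> \<Gamma>" for x
      using S.m_inv_closed[OF that] by (simp add: inv)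
  qed
  show ?thesis using homology_iso by simp
qed

end
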